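(* Let $\mathcal M(\mathfrak s)=(\mathrm I_{\mathfrak s}\times\mathbb S^3,\ \ell_{\mathfrak s}=-dt^2+\mathfrak s^2(t)g)$ be a closed Robertson–Walker (RW) spacetime with nonconstant scale function $\mathfrak s$, cosmological constant $\Lambda$ and source a perfect fluid with energy density $\mathfrak m$ and pressure $\mathfrak p$. Then $\mathcal M(\mathfrak s)$ is $\mathfrak m$-critical if and only if there exist two constants $\mathfrak a,\mathcal H\in\mathbb R$ (called the internal parameters) such that $$\mathfrak s\left(\dot{\mathfrak s}^2+\frac{\mathfrak a}{3}\mathfrak s^2-1\right)=\mathcal H .$$ In addition, the state equation of an $\mathfrak m$-critical spacetime with internal parameters $\mathfrak a$ and $\mathcal H$ is $$\frac{8\pi}{3}\mathfrak m+8\pi\mathfrak p-\frac23(\Lambda+\mathfrak a)-\frac{\mathcal H}{2\sqrt2}\,(\Lambda+\mathfrak a-8\pi\mathfrak p)^{3/2}=0 .$$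
   Context: Let $g$ be the standard Riemannian metric of the unit sphere $\mathbb S^3\subset\mathbb R^4$. A closed RW spacetime is $\mathcal M(\mathfrak s)=\mathrm I_{\mathfrak s}\times\mathbb S^3$, where $\mathrm I_{\mathfrak s}\subset\mathbb R$ is an open interval and $\mathfrak s$ is a nonnegative smooth function on $\mathrm I_{\mathfrak s}$ (the scale function), with the (possibly degenerate) Lorentz metric $\ell_{\mathfrak s}=-dt^2+\mathfrak s^2(t)g$. It is endowed with a cosmological constant $\Lambda\in\mathbb R$ and the perfect fluid stress-energy tensor $\mathrm T=\mathfrak m\,dt^2+\mathfrak p\,\mathfrak s^2g$, where the energy density $\mathfrak m$ and the pressure $\mathfrak p$ depend only on $t$. The Einstein equation $\rho_{\mathfrak s}+(\Lambda-\frac12\sigma_{\mathfrak s})\ell_{\mathfrak s}=8\pi\mathrm T$ ($\rho_{\mathfrak s}$ and $\sigma_{\mathfrak s}$ being the Ricci tensor and the scalar curvature of $\ell_{\mathfrak s}$) is assumed; it is equivalent to $$\mathfrak m=\frac{3}{8\pi}\left(\frac{\dot{\mathfrak s}^2}{\mathfrak s^2}+\frac1{\mathfrak s^2}-\frac{\Lambda}{3}\right),\qquad \mathfrak p=-\frac1{4\pi\mathfrak s}\left(\ddot{\mathfrak s}+\frac1{2\mathfrak s}(\dot{\mathfrak s}^2+1)-\frac\Lambda2\mathfrak s\right).$$ A dot is the derivative with respect to $t$; equations involving $\mathfrak s$ are understood where $\mathfrak s>0$. The total energy of a compact domain $\mathcal D=[t_0,t_1]\times\mathbb S^3$, $[t_0,t_1]\subset\mathrm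 I_{\mathfrak s}$, is $\mathfrak M=\int_{\mathcal D}\mathfrak m\,dV_{\ell_{\mathfrak s}}$, where $dV_{\ell_{\mathfrak s}}=\mathfrak s^3dt\wedge d\upsilon$ is the volume element of $\ell_{\mathfrak s}$ ($d\upsilon$ the volume element of $\mathbb S^3$), and $\mathfrak m$ is given in terms of $\mathfrak s$ by the formula above with $\Lambda$ fixed. The spacetime is called $\mathfrak m$-critical if $\mathfrak s$ is a critical point of $\mathfrak M$ with respect to (fixed-endpoint) variations of the scale function that preserve the volume, i.e. that keep $\int_{t_0}^{t_1}\mathfrak s^3dt$ constant. With Lagrange multiplier $\lambda$ for this constraint and $\mathfrak a=\Lambda+\lambda$, criticality is expressed by the Euler–Lagrange equation of the Lagrangian $L(\mathfrak s,\dot{\mathfrak s})=\mathfrak s\left(\dot{\mathfrak s}^2-\frac{\mathfrak a}{3}\mathfrak s^2+1\right)$. *)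

theory Defs
  imports "HOL-Analysis.Analysis"
begin

text \<open>\<open>C_k_on k S f\<close>: \<open>f\<close> is of class \<open>C\<^sup>k\<close> on the open set \<open>S\<close>.\<close>

fun C_k_on :: "nat \<Rightarrow> 'a::real_normed_vector set \<Rightarrow> ('a \<Rightarrow> 'b::real_normed_vector) \<Rightarrow> bool" where
  "C_k_on 0 S f \<longleftrightarrow> continuous_on S f"
| "C_k_on (Suc k) S f \<longleftrightarrow>
     (\<forall>x\<in>S. f differentiable (at x)) \<and> (\<forall>v. C_k_on k S (\<lambda>x. frechet_derivative f (at x) v))"

definition smooth_on :: "'a::real_normed_vector set \<Rightarrow> ('a \<Rightarrow> 'b::real_normed_vector) \<Rightarrow> bool" where
  "smooth_on S f \<longleftrightarrow> (\<forall>k. C_k_on k S f)"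

text \<open>
  Curvature of a pseudo-Riemannian metric in a chart with coordinates \<open>x $ i\<close>; the metric is given
  by the matrix \<open>G x\<close> of its components, and \<open>christoffel G k i j\<close> is the symbol with upper index \<open>k\<close>.
\<close>

definition partial :: "'n::finite \<Rightarrow> (real^'n \<Rightarrow> 'b::real_normed_vector) \<Rightarrow> real^'n \<Rightarrow> 'b" where
  "partial i f x = vector_derivative (\<lambda>h. f (x + h *\<^sub>R axis i 1)) (at 0)"

definition christoffel ::
  "(real^'n \<Rightarrow> real^'n^'n) \<Rightarrow> 'n::finite \<Rightarrow> 'n \<Rightarrow> 'n \<Rightarrow> real^'n \<Rightarrow> real" where
  "christoffel G k i j x =
     (\<Sum>l\<in>UNIV. matrix_inv (G x) $ k $ l *
        (partial i (\<lambda>y. G y $ j $ l) x + partial j (\<lambda>y. G y $ i $ l) x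
          - partial l (\<lambda>y. G y $ i $ j) x)) / 2"

definition ricci :: "(real^'n \<Rightarrow> real^'n^'n) \<Rightarrow> real^'n \<Rightarrow> 'n::finite \<Rightarrow> 'n \<Rightarrow> real" where
  "ricci G x i j =
     (\<Sum>k\<in>UNIV. partial k (christoffel G k i j) x - partial j (christoffel G k i k) x
       + (\<Sum>l\<in>UNIV. christoffel G k k l x * christoffel G l i j x
                  - christoffel G k j l x * christoffel G l i k x))"

definition scalar_curvature :: "(real^'n \<Rightarrow> real^'n^'n) \<Rightarrow> real^'n::finite \<Rightarrow> real" where
  "scalar_curvature G x = (\<Sum>i\<in>UNIV. \<Sum>j\<in>UNIV. matrix_inv (G x) $ i $ j * ricci G x i j)"

text \<open>
  Coordinates on \<open>\<real> \<times> S\<^sup>3\<close>: \<open>x $ 1\<close> is the time \<open>t\<close>, and \<open>(x $ 2, x $ 3, x $ 4)\<close> are the stereographic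
  coordinates of the point \<open>stereo e x\<close> of \<open>S\<^sup>3 \<subseteq> \<real>\<^sup>4\<close>, projected from the pole \<open>(0, 0, 0, e)\<close>.
  The two charts \<open>e = 1\<close> and \<open>e = -1\<close> cover \<open>\<real> \<times> S\<^sup>3\<close>.
\<close>

definition stereo :: "real \<Rightarrow> real^4 \<Rightarrow> real^4" where
  "stereo e x = (let q = (x $ 2)\<^sup>2 + (x $ 3)\<^sup>2 + (x $ 4)\<^sup>2 in
     (\<chi> i. if i = 1 then 2 * x $ 2 / (1 + q)
          else if i = 2 then 2 * x $ 3 / (1 + q)
          else if i = 3 then 2 * x $ 4 / (1 + q)
          else e * (q - 1) / (1 + q)))"

text \<open>
  The components of \<open>g\<close> (pulled back to \<open>\<real> \<times> S\<^sup>3\<close>): the metric induced by the Euclidean inner product.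
\<close>

definition sphere_metric :: "real \<Rightarrow> real^4 \<Rightarrow> 4 \<Rightarrow> 4 \<Rightarrow> real" where
  "sphere_metric e x i j = partial i (stereo e) x \<bullet> partial j (stereo e) x"

definition dt :: "4 \<Rightarrow> real" where
  "dt i = (if i = 1 then 1 else 0)"

definition rw_metric :: "(real \<Rightarrow> real) \<Rightarrow> real \<Rightarrow> real^4 \<Rightarrow> real^4^4" where
  "rw_metric s e x = (\<chi> i j. - dt i * dt j + (s (x $ 1))\<^sup>2 * sphere_metric e x i j)"

definition perfect_fluid ::
  "(real \<Rightarrow> real) \<Rightarrow> (real \<Rightarrow> real) \<Rightarrow> (real \<Rightarrow> real) \<Rightarrow> real \<Rightarrow> real^4 \<Rightarrow> 4 \<Rightarrow> 4 \<Rightarrow> real" where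
  "perfect_fluid s m p e x i j =
     m (x $ 1) * dt i * dt j + p (x $ 1) * (s (x $ 1))\<^sup>2 * sphere_metric e x i j"

definition einstein_equation ::
  "real set \<Rightarrow> (real \<Rightarrow> real) \<Rightarrow> real \<Rightarrow> (real \<Rightarrow> real) \<Rightarrow> (real \<Rightarrow> real) \<Rightarrow> bool" where
  "einstein_equation I s \<Lambda> m p \<longleftrightarrow>
     (\<forall>e\<in>{1, -1}. \<forall>x. x $ 1 \<in> I \<and> s (x $ 1) > 0 \<longrightarrow>
       (\<forall>i j. ricci (rw_metric s e) x i j
           + (\<Lambda> - scalar_curvature (rw_metric s e) x / 2) * rw_metric s e x $ i $ j
         = 8 * pi * perfect_fluid s m p e x i j))"

definition closed_RW_spacetime ::
  "real set \<Rightarrow> (real \<Rightarrow> real) \<Rightarrow> real \<Rightarrow> (real \<Rightarrow> real) \<Rightarrow> (real \<Rightarrow> real) \<Rightarrow> bool" where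
  "closed_RW_spacetime I s \<Lambda> m p \<longleftrightarrow>
     open I \<and> is_interval I \<and> I \<noteq> {} \<and> smooth_on I s \<and> (\<forall>t\<in>I. 0 \<le> s t) \<and>
     einstein_equation I s \<Lambda> m p"

definition energy_density :: "real \<Rightarrow> (real \<Rightarrow> real) \<Rightarrow> real \<Rightarrow> real" where
  "energy_density \<Lambda> s t =
     3 / (8 * pi) * ((deriv s t)\<^sup>2 / (s t)\<^sup>2 + 1 / (s t)\<^sup>2 - \<Lambda> / 3)"

text \<open>
  The measure of the volume element of \<open>S\<^sup>3\<close>: as Lebesgue measure on \<open>\<real>\<^sup>4\<close> is \<open>r\<^sup>3 dr d\<upsilon>\<close> in polar
  coordinates, the measure of \<open>A\<close> is four times that of the cone \<open>{r x | 0 < r < 1, x \<in> A}\<close>.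
\<close>

definition sphere_measure :: "(real^4) measure" where
  "sphere_measure = scale_measure 4
     (distr (restrict_space lborel (ball 0 1 - {0})) (restrict_space borel (sphere 0 1))
       (\<lambda>x. x /\<^sub>R norm x))"

definition total_energy :: "real \<Rightarrow> (real \<Rightarrow> real) \<Rightarrow> real \<Rightarrow> real \<Rightarrow> real" where
  "total_energy \<Lambda> s t0 t1 =
     (LINT z:{t0..t1} \<times> sphere 0 1|(lborel \<Otimes>\<^sub>M sphere_measure).
        energy_density \<Lambda> s (fst z) * s (fst z) ^ 3)"

text \<open>
  A fixed-endpoint, volume-preserving variation \<open>F (\<epsilon>, t)\<close>, \<open>\<bar>\<epsilon>\<bar> < \<delta>\<close>, of \<open>s\<close> on \<open>[t0, t1]\<close> through
  (nonnegative) scale functions. It is smooth up to the endpoints, in the sense of being smooth on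
  a neighbourhood.
\<close>

definition admissible_variation ::
  "(real \<Rightarrow> real) \<Rightarrow> real \<Rightarrow> real \<Rightarrow> real \<Rightarrow> (real \<times> real \<Rightarrow> real) \<Rightarrow> bool" where
  "admissible_variation s t0 t1 \<delta> F \<longleftrightarrow>
     \<delta> > 0 \<and>
     (\<exists>\<eta>>0. smooth_on ({-\<delta><..<\<delta>} \<times> {t0-\<eta><..<t1+\<eta>}) F) \<and>
     (\<forall>t\<in>{t0..t1}. F (0, t) = s t) \<and>
     (\<forall>\<epsilon>\<in>{-\<delta><..<\<delta>}. \<forall>t\<in>{t0..t1}. 0 \<le> F (\<epsilon>, t)) \<and>
     (\<forall>\<epsilon>\<in>{-\<delta><..<\<delta>}. F (\<epsilon>, t0) = s t0 \<and> F (\<epsilon>, t1) = s t1) \<and>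
     (\<forall>\<epsilon>\<in>{-\<delta><..<\<delta>}. integral {t0..t1} (\<lambda>t. F (\<epsilon>, t) ^ 3) = integral {t0..t1} (\<lambda>t. s t ^ 3))"

definition m_critical :: "real \<Rightarrow> real set \<Rightarrow> (real \<Rightarrow> real) \<Rightarrow> bool" where
  "m_critical \<Lambda> I s \<longleftrightarrow>
     (\<forall>t0 t1 \<delta> F. t0 < t1 \<and> {t0..t1} \<subseteq> I \<and> admissible_variation s t0 t1 \<delta> F \<longrightarrow>
        ((\<lambda>\<epsilon>. total_energy \<Lambda> (\<lambda>t. F (\<epsilon>, t)) t0 t1) has_real_derivative 0) (at 0))"

definition internal_parameters :: "real set \<Rightarrow> (real \<Rightarrow> real) \<Rightarrow> real \<Rightarrow> real \<Rightarrow> bool" where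
  "internal_parameters I s a H \<longleftrightarrow>
     (\<forall>t\<in>I. s t > 0 \<longrightarrow> s t * ((deriv s t)\<^sup>2 + a / 3 * (s t)\<^sup>2 - 1) = H)"

text \<open>
  Consistency of the above: the measure of \<open>S\<^sup>3\<close> is \<open>2 \<pi>\<^sup>2\<close>, and the Einstein equation is
  equivalent to the usual formulas for the energy density and the pressure. The Ricci tensor is
  computed with \<open>conf_grad i = \<partial>\<^sub>i (log (2 / (1 + |y|\<^sup>2)))\<close> and \<open>hubble = s' / s\<close>.
\<close>

lemma partial_eqI:
  assumes "(f has_derivative f') (at x)"
  shows "partial i f x = f' (axis i 1)"
proof -
  interpret f': bounded_linear f' using assms by (rule has_derivative_bounded_linear)
  have "((\<lambda>h::real. x + h *\<^sub>R axis i 1) has_derivative (\<lambda>h. h *\<^sub>R axis i 1)) (at 0)"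
    by (auto intro!: derivative_eq_intros)
  moreover have "(f has_derivative f') (at (x + 0 *\<^sub>R axis i 1))" using assms by simp
  ultimately have "((\<lambda>h. f (x + h *\<^sub>R axis i 1)) has_derivative (\<lambda>h. f' (h *\<^sub>R axis i 1))) (at 0)"
    by (rule has_derivative_compose)
  then have "((\<lambda>h. f (x + h *\<^sub>R axis i 1)) has_vector_derivative f' (axis i 1)) (at 0)"
    unfolding has_vector_derivative_def by (simp add: f'.scaleR)
  then show ?thesis unfolding partial_def by (rule vector_derivative_at)
qed

lemma partial_cong:
  assumes "eventually (\<lambda>y. f y = g y) (nhds x)"
  shows "partial i f x = partial i g x"
proof -
  have "filterlim (\<lambda>h::real. x + h *\<^sub>R axis i 1) (nhds (x + 0 *\<^sub>R axis i 1)) (nhds 0)"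
    by (intro tendsto_intros filterlim_ident)
  then have "filterlim (\<lambda>h::real. x + h *\<^sub>R axis i 1) (nhds x) (nhds 0)" by simp
  then have "eventually (\<lambda>h. f (x + h *\<^sub>R axis i 1) = g (x + h *\<^sub>R axis i 1)) (nhds 0)"
    using assms by (auto simp: filterlim_iff)
  then show ?thesis unfolding partial_def
    by (intro vector_derivative_cong_eq) (auto simp: eventually_at_filter elim: eventually_mono)
qed

definition stereo_denom :: "real^4 \<Rightarrow> real" where "stereo_denom x = 1 + ((x $ 2)\<^sup>2 + (x $ 3)\<^sup>2 + (x $ 4)\<^sup>2)"
definition spatial :: "4 \<Rightarrow> real" where "spatial i = (if i = 1 then 0 else 1)"

lemma distinct_4 [simp]: "(1::4) \<noteq> 2" "(1::4) \<noteq> 3" "(1::4) \<noteq> 4" "(2::4) \<noteq> 3" "(2::4) \<noteq> 4" "(3::4) \<noteq> 4"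
   "(2::4) \<noteq> 1" "(3::4) \<noteq> 1" "(4::4) \<noteq> 1" "(3::4) \<noteq> 2" "(4::4) \<noteq> 2" "(4::4) \<noteq> 3"
  by simp_all

lemma spatial_simps [simp]: "spatial 1 = 0" "spatial 2 = 1" "spatial 3 = 1" "spatial 4 = 1" by (simp_all add: spatial_def)

lemma stereo_denom_pos: "stereo_denom x > 0" by (simp add: stereo_denom_def add_pos_nonneg)
lemma stereo_denom_nonzero [simp]: "stereo_denom x \<noteq> 0" using stereo_denom_pos[of x] by simp

lemma vec_nth_has_derivative: "((\<lambda>x. x $ i) has_derivative (\<lambda>v. v $ i)) (at x)" for x :: "real^'n"
  by (rule bounded_linear_imp_has_derivative[OF bounded_linear_vec_nth])

lemma stereo_denom_has_derivative: "(stereo_denom has_derivative (\<lambda>v. 2 * (x$2 * v$2 + x$3* v$3 + x$4* v$4))) (at x)"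
  unfolding stereo_denom_def
  by (rule has_derivative_eq_rhs, (rule derivative_intros vec_nth_has_derivative)+) (simp add: algebra_simps)

lemma stereo_alt: "stereo e = (\<lambda>x. (2 * x $ 2 / stereo_denom x) *\<^sub>R axis 1 1 + (2 * x $ 3 / stereo_denom x) *\<^sub>R axis 2 1
   + (2 * x $ 4 / stereo_denom x) *\<^sub>R axis 3 1 + (e * (stereo_denom x - 2) / stereo_denom x) *\<^sub>R axis 4 1)"
  by (auto simp: stereo_def fun_eq_iff vec_eq_iff forall_4 axis_def stereo_denom_def Let_def)

definition stereo_deriv_base where "stereo_deriv_base i x v = (2 * v $ i) / stereo_denom x - 2 * x $ i * (2 * (x$2 * v$2 + x$3* v$3 + x$4* v$4)) / (stereo_denom x)\<^sup>2" for x v :: "real^4"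
definition stereo_deriv_pole where "stereo_deriv_pole e x v = 2 * e * (2 * (x$2 * v$2 + x$3* v$3 + x$4* v$4)) / (stereo_denom x)\<^sup>2" for x v :: "real^4"

lemma stereo_base_has_derivative: "((\<lambda>x. 2 * x $ i / stereo_denom x) has_derivative stereo_deriv_base i x) (at x)"
  unfolding stereo_deriv_base_def
  by (rule has_derivative_eq_rhs, (rule derivative_intros vec_nth_has_derivative stereo_denom_has_derivative stereo_denom_nonzero)+)
     (auto simp: fun_eq_iff divide_simps, auto simp: algebra_simps power2_eq_square)

lemma stereo_pole_has_derivative: "((\<lambda>x. e * (stereo_denom x - 2) / stereo_denom x) has_derivative stereo_deriv_pole e x) (at x)"
  unfolding stereo_deriv_pole_def
  by (rule has_derivative_eq_rhs, (rule derivative_intros vec_nth_has_derivative stereo_denom_has_derivative stereo_denom_nonzero)+)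
     (auto simp: fun_eq_iff divide_simps, auto simp: algebra_simps power2_eq_square)

lemma stereo_has_derivative: "(stereo e has_derivative (\<lambda>v. stereo_deriv_base 2 x v *\<^sub>R axis 1 1 + stereo_deriv_base 3 x v *\<^sub>R axis 2 1
   + stereo_deriv_base 4 x v *\<^sub>R axis 3 1 + stereo_deriv_pole e x v *\<^sub>R axis 4 1)) (at x)"
  unfolding stereo_alt
  by (intro has_derivative_add has_derivative_scaleR_left stereo_base_has_derivative stereo_pole_has_derivative)

lemma sphere_metric_eq:
  assumes "e \<in> {1, -1}"
  shows "sphere_metric e x i j = (if i = j then spatial i * 4 / (stereo_denom x)\<^sup>2 else 0)"
proof -
  have e2: "e * e = 1" using assms by auto
  have ax: "axis i (1::real) $ j = (if i = j then 1 else 0)" for i j :: 4 by (simp add: axis_def)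
  have inn: "(a1 *\<^sub>R axis (1::4) 1 + a2 *\<^sub>R axis 2 1 + a3 *\<^sub>R axis 3 1 + a4 *\<^sub>R axis 4 1) \<bullet>
     (b1 *\<^sub>R axis (1::4) 1 + b2 *\<^sub>R axis 2 1 + b3 *\<^sub>R axis 3 1 + b4 *\<^sub>R axis 4 (1::real))
     = a1*b1+a2*b2+a3*b3+a4*b4" for a1 a2 a3 a4 b1 b2 b3 b4 :: real
    by (simp add: inner_add_left inner_add_right inner_axis_axis)
  define y where "y = stereo_denom x"
  have y: "y \<noteq> 0" by (simp add: y_def)
  have y1: "(x $ 2)\<^sup>2 + (x $ 3)\<^sup>2 + (x $ 4)\<^sup>2 + 1 = y" by (simp add: y_def stereo_denom_def)
  define X where "X i = spatial i * x $ i" for i :: 4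
  define u where "u = 1 / y"
  have F: "stereo_deriv_base k x (axis i 1) = (if k = i then 2 * u else 0) - 4 * x$k * X i * u\<^sup>2" if "k \<noteq> 1" for k i
    using exhaust_4[of i] that by (auto simp: stereo_deriv_base_def ax y_def[symmetric] X_def u_def power_divide)
  have F4: "stereo_deriv_pole e x (axis i 1) = 4 * e * X i * u\<^sup>2" for i
    using exhaust_4[of i] by (auto simp: stereo_deriv_pole_def ax y_def[symmetric] X_def u_def power_divide)
  have "sphere_metric e x i j = 
    stereo_deriv_base 2 x (axis i 1) * stereo_deriv_base 2 x (axis j 1) + stereo_deriv_base 3 x (axis i 1) * stereo_deriv_base 3 x (axis j 1)
    + stereo_deriv_base 4 x (axis i 1) * stereo_deriv_base 4 x (axis j 1) + stereo_deriv_pole e x (axis i 1) * stereo_deriv_pole e x (axis j 1)"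
    unfolding sphere_metric_def partial_eqI[OF stereo_has_derivative] inn by simp
  also have "stereo_deriv_pole e x (axis i 1) * stereo_deriv_pole e x (axis j 1) = (e * e) * (16 * X i * X j * u^4)"
    unfolding F4 by (simp add: algebra_simps power4_eq_xxxx power2_eq_square)
  also have "stereo_deriv_base 2 x (axis i 1) * stereo_deriv_base 2 x (axis j 1) + stereo_deriv_base 3 x (axis i 1) * stereo_deriv_base 3 x (axis j 1)
    + stereo_deriv_base 4 x (axis i 1) * stereo_deriv_base 4 x (axis j 1) + (e * e) * (16 * X i * X j * u^4)
    = (if i = j then spatial i * 4 * u\<^sup>2 else 0) 
       + 16 * (((x$2)\<^sup>2 + (x$3)\<^sup>2 + (x$4)\<^sup>2 + 1) * u - 1) * X i * X j * u^3"
    unfolding e2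
    using exhaust_4[of i] exhaust_4[of j]
    by (elim disjE; simp add: F X_def; simp add: algebra_simps power2_eq_square power3_eq_cube power4_eq_xxxx)
  also have "((x$2)\<^sup>2 + (x$3)\<^sup>2 + (x$4)\<^sup>2 + 1) * u = 1"
    unfolding y1 using y by (simp add: u_def)
  finally show ?thesis unfolding y_def[symmetric] u_def by (simp add: power_divide)
qed

definition conf_grad :: "4 \<Rightarrow> real^4 \<Rightarrow> real" where "conf_grad j x = - 2 * spatial j * x $ j / stereo_denom x"
definition hubble :: "(real \<Rightarrow> real) \<Rightarrow> real^4 \<Rightarrow> real" where "hubble s x = deriv s (x $ 1) / s (x $ 1)"
definition spatial_factor :: "(real \<Rightarrow> real) \<Rightarrow> real^4 \<Rightarrow> real" where "spatial_factor s x = (s (x $ 1))\<^sup>2 * (4 / (stereo_denom x)\<^sup>2)"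

lemma dt_simps [simp]: "dt 1 = 1" "dt 2 = 0" "dt 3 = 0" "dt 4 = 0" by (simp_all add: dt_def)

lemma axis_nth_4: "axis i (1::real) $ j = (if i = j then 1 else 0)" for i j :: 4 by (simp add: axis_def)

lemma rw_metric_eq:
  assumes "e \<in> {1, -1}"
  shows "rw_metric s e x $ i $ j = (if i = j then (if i = 1 then -1 else spatial_factor s x) else 0)"
  using exhaust_4[of i] exhaust_4[of j]
  by (elim disjE) (simp_all add: rw_metric_def sphere_metric_eq[OF assms] spatial_factor_def)

lemma matrix_inv_unique:
  fixes A B :: "real^'n^'n"
  assumes "A ** B = mat 1" "B ** A = mat 1"
  shows "matrix_inv A = B"
proof -
  have "A ** matrix_inv A = mat 1 \<and> matrix_inv A ** A = mat 1"
    unfolding matrix_inv_def by (rule someI[of _ B]) (use assms in auto)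
  then show ?thesis by (metis assms(2) matrix_mul_assoc matrix_mul_lid matrix_mul_rid)
qed

lemma matrix_inv_rw_metric:
  assumes "e \<in> {1, -1}" "s (x $ 1) > 0"
  shows "matrix_inv (rw_metric s e x) $ i $ j = (if i = j then (if i = 1 then -1 else 1 / spatial_factor s x) else 0)"
proof -
  define B :: "real^4^4" where "B = (\<chi> i j. (if i = j then (if i = 1 then -1 else 1 / spatial_factor s x) else 0))"
  have P: "spatial_factor s x \<noteq> 0" using assms(2) stereo_denom_nonzero[of x] by (simp add: spatial_factor_def)
  have "rw_metric s e x ** B = mat 1" "B ** rw_metric s e x = mat 1"
    unfolding matrix_matrix_mult_def vec_eq_iff forall_4 sum_4
    by (simp_all add: rw_metric_eq[OF assms(1)] B_def mat_def P)
  then have "matrix_inv (rw_metric s e x) = B" by (rule matrix_inv_unique)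
  then show ?thesis by (simp add: B_def)
qed

lemma time_comp_has_derivative:
  assumes "(f has_real_derivative d) (at (x $ 1))"
  shows "((\<lambda>x. f (x $ 1)) has_derivative (\<lambda>v. d * v $ 1)) (at (x::real^4))"
  using has_derivative_compose[OF vec_nth_has_derivative[of 1 x] assms[unfolded has_field_derivative_def]] .

lemma partial_spatial_factor:
  assumes "(s has_real_derivative deriv s (x $ 1)) (at (x $ 1))" "s (x $ 1) > 0"
  shows "partial i (spatial_factor s) x = 2 * spatial_factor s x * (hubble s x * dt i + conf_grad i x)"
proof -
  have "(spatial_factor s has_derivative (\<lambda>v. 2 * s (x$1) * (deriv s (x$1) * v $ 1) * (4 / (stereo_denom x)\<^sup>2) 
     - (s (x$1))\<^sup>2 * (8 * (2 * (x$2 * v$2 + x$3* v$3 + x$4* v$4))) / (stereo_denom x)^3)) (at x)"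
    unfolding spatial_factor_def
    by (rule has_derivative_eq_rhs, (rule derivative_intros time_comp_has_derivative assms stereo_denom_has_derivative stereo_denom_nonzero)+)
     (auto simp: fun_eq_iff divide_simps, auto simp: algebra_simps eval_nat_numeral)
  from partial_eqI[OF this, of i] show ?thesis using exhaust_4[of i] assms(2)
    by (elim disjE) (simp_all add: axis_nth_4 hubble_def spatial_factor_def conf_grad_def field_simps power2_eq_square power3_eq_cube)
qed

lemma hubble_has_derivative:
  assumes "(s has_real_derivative deriv s (x $ 1)) (at (x $ 1))" "s (x $ 1) > 0"
    "(deriv s has_real_derivative deriv (deriv s) (x $ 1)) (at (x $ 1))"
  shows "(hubble s has_derivative (\<lambda>v. (deriv (deriv s) (x$1) / s (x$1) - (hubble s x)\<^sup>2) * v $ 1)) (at x)"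
proof -
  have nz: "s (x $ 1) \<noteq> 0" using assms by simp
  show ?thesis
    unfolding hubble_def
    by (rule has_derivative_eq_rhs, (rule derivative_intros time_comp_has_derivative assms nz)+)
     (use nz in \<open>simp_all add: fun_eq_iff field_simps power2_eq_square\<close>)
qed

lemma conf_grad_has_derivative:
  "(conf_grad k has_derivative (\<lambda>v. - 2 * spatial k * v $ k / stereo_denom x + 
    2 * spatial k * x $ k * (2 * (x$2 * v$2 + x$3* v$3 + x$4* v$4)) / (stereo_denom x)\<^sup>2)) (at x)"
    unfolding conf_grad_def
    by (rule has_derivative_eq_rhs, (rule derivative_intros vec_nth_has_derivative stereo_denom_has_derivative stereo_denom_nonzero)+)
     (auto simp: fun_eq_iff divide_simps, auto simp: algebra_simps power2_eq_square)

lemma partial_conf_grad: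
  "partial i (conf_grad k) x = (if i = k then - 2 * spatial k / stereo_denom x else 0) + conf_grad i x * conf_grad k x"
  unfolding partial_eqI[OF conf_grad_has_derivative] using exhaust_4[of i]
  by (elim disjE) (simp_all add: axis_nth_4 conf_grad_def power2_eq_square)

definition rw_christoffel :: "(real \<Rightarrow> real) \<Rightarrow> 4 \<Rightarrow> 4 \<Rightarrow> 4 \<Rightarrow> real^4 \<Rightarrow> real" where
  "rw_christoffel s k i j x = (if k = 1 then (if i = j then spatial i * (spatial_factor s x * hubble s x) else 0)
     else (if j = k then hubble s x * dt i + conf_grad i x else 0) + (if i = k then hubble s x * dt j + conf_grad j x else 0)
       - (if i = j then spatial i * conf_grad k x else 0))"

lemma partial_const: "partial i (\<lambda>x. c) x = 0"
  unfolding partial_def by simp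

lemma partial_rw_metric:
  assumes "e \<in> {1, -1}" "(s has_real_derivative deriv s (x $ 1)) (at (x $ 1))" "s (x $ 1) > 0"
  shows "partial i (\<lambda>y. rw_metric s e y $ j $ l) x =
    (if j = l then spatial j * (2 * spatial_factor s x * (hubble s x * dt i + conf_grad i x)) else 0)"
  unfolding rw_metric_eq[OF assms(1)]
  using partial_spatial_factor[OF assms(2,3), of i] by (auto simp: partial_const spatial_def)

lemma christoffel_rw_metric:
  assumes "e \<in> {1, -1}" "(s has_real_derivative deriv s (x $ 1)) (at (x $ 1))" "s (x $ 1) > 0"
  shows "christoffel (rw_metric s e) k i j x = rw_christoffel s k i j x"
proof -
  have P: "spatial_factor s x \<noteq> 0" using assms(3) stereo_denom_nonzero[of x] by (simp add: spatial_factor_def)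
  have W1: "conf_grad 1 x = 0" by (simp add: conf_grad_def)
  have "christoffel (rw_metric s e) k i j x = (if k = 1 then -1 else 1 / spatial_factor s x) *
      ((if j = k then spatial j * (2 * spatial_factor s x * (hubble s x * dt i + conf_grad i x)) else 0)
      + (if i = k then spatial i * (2 * spatial_factor s x * (hubble s x * dt j + conf_grad j x)) else 0)
      - (if i = j then spatial i * (2 * spatial_factor s x * (hubble s x * dt k + conf_grad k x)) else 0)) / 2"
    unfolding christoffel_def matrix_inv_rw_metric[where s=s, OF assms(1,3)] partial_rw_metric[OF assms]
    by (simp add: if_distrib[of "\<lambda>x. x * _"] sum.delta cong: if_cong)
  also have "\<dots> = rw_christoffel s k i j x"
    unfolding rw_christoffel_def using P W1 by (auto simp: spatial_def dt_def field_simps)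
  finally show ?thesis .
qed

definition christoffel_comb where "christoffel_comb s c1 c2 a b d i j k x = c1 * (spatial_factor s x * hubble s x) + c2 * hubble s x + a * conf_grad i x + b * conf_grad j x + d * conf_grad k x"

lemma spatial_factor_differentiable:
  assumes "(s has_real_derivative deriv s (x $ 1)) (at (x $ 1))"
  shows "\<exists>P'. (spatial_factor s has_derivative P') (at x)"
  unfolding spatial_factor_def
  by (rule exI, (rule derivative_intros time_comp_has_derivative assms stereo_denom_has_derivative stereo_denom_nonzero)+) simp

lemma partial_christoffel_comb:
  assumes "(s has_real_derivative deriv s (x $ 1)) (at (x $ 1))" "s (x $ 1) > 0"
    "(deriv s has_real_derivative deriv (deriv s) (x $ 1)) (at (x $ 1))"
  shows "partial n (christoffel_comb s c1 c2 a b d i j k) x = 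
    c1 * (partial n (spatial_factor s) x * hubble s x + spatial_factor s x * partial n (hubble s) x) + c2 * partial n (hubble s) x +
    a * partial n (conf_grad i) x + b * partial n (conf_grad j) x + d * partial n (conf_grad k) x"
proof -
  obtain P' where P: "(spatial_factor s has_derivative P') (at x)" using spatial_factor_differentiable[of s x] assms by auto
  obtain h' where h: "(hubble s has_derivative h') (at x)" using hubble_has_derivative[of s x] assms by auto
  obtain i' where i: "(conf_grad i has_derivative i') (at x)" using conf_grad_has_derivative by blast
  obtain j' where j: "(conf_grad j has_derivative j') (at x)" using conf_grad_has_derivative by blast
  obtain k' where k: "(conf_grad k has_derivative k') (at x)" using conf_grad_has_derivative by blast
  have "(christoffel_comb s c1 c2 a b d i j k has_derivative (\<lambda>v. c1 * (spatial_factor s x * h' v + P' v * hubble s x) + c2 * h' v + a * i' v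
      + b * j' v + d * k' v)) (at x)"
    unfolding christoffel_comb_def
    by (intro has_derivative_add has_derivative_mult_right has_derivative_mult P h i j k)
  from partial_eqI[OF this, of n] show ?thesis
    using partial_eqI[OF P, of n] partial_eqI[OF h, of n]
     partial_eqI[OF i, of n] partial_eqI[OF j, of n] partial_eqI[OF k, of n] by simp
qed

lemma rw_christoffel_eq_comb: "rw_christoffel s k i j = (if k = 1 then christoffel_comb s (if i = j then spatial i else 0) 0 0 0 0 i j k
    else christoffel_comb s 0 ((if j = k then dt i else 0) + (if i = k then dt j else 0)) (if j = k then 1 else 0)
       (if i = k then 1 else 0) (if i = j then - spatial i else 0) i j k)"
  by (auto simp: fun_eq_iff rw_christoffel_def christoffel_comb_def algebra_simps)

context
  fixes I :: "real set" and s :: "real \<Rightarrow> real"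
  assumes I: "open I"
    and d1: "\<And>t. t \<in> I \<Longrightarrow> (s has_real_derivative deriv s t) (at t)"
    and d2: "\<And>t. t \<in> I \<Longrightarrow> (deriv s has_real_derivative deriv (deriv s) t) (at t)"
begin

lemma partial_christoffel:
  assumes "x $ 1 \<in> I" "s (x $ 1) > 0" "e \<in> {1, -1}"
  shows "partial n (christoffel (rw_metric s e) k i j) x = partial n (rw_christoffel s k i j) x"
proof (rule partial_cong)
  have "isCont s (x $ 1)" using d1[OF assms(1)] by (rule DERIV_isCont)
  have c: "((\<lambda>y. y $ 1) \<longlongrightarrow> x $ 1) (nhds x)" by (intro tendsto_intros filterlim_ident)
  have "(s \<longlongrightarrow> s (x $ 1)) (nhds (x $ 1))"
    using \<open>isCont s (x $ 1)\<close> by (simp add: continuous_at tendsto_nhds_iff)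
  then have "((\<lambda>y. s (y $ 1)) \<longlongrightarrow> s (x $ 1)) (nhds x)" using c by (rule filterlim_compose)
  then have "eventually (\<lambda>y. s (y $ 1) > 0) (nhds x)" using assms(2) by (rule order_tendstoD)
  moreover have "eventually (\<lambda>y. y $ 1 \<in> I) (nhds x)" using c I assms(1) by (rule topological_tendstoD)
  ultimately show "eventually (\<lambda>y. christoffel (rw_metric s e) k i j y = rw_christoffel s k i j y) (nhds x)"
    by eventually_elim (rule christoffel_rw_metric[OF assms(3) d1])
qed

lemma ricci_rw_metric:
  assumes "x $ 1 \<in> I" "s (x $ 1) > 0" "e \<in> {1, -1}"
  defines "S \<equiv> s (x $ 1)" and "S' \<equiv> deriv s (x $ 1)" and "S'' \<equiv> deriv (deriv s) (x $ 1)"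
  shows "ricci (rw_metric s e) x i j = (if i \<noteq> j then 0 else if i = 1 then - 3 * S'' / S
      else (S * S'' + 2 * S'\<^sup>2 + 2) * (4 / (stereo_denom x)\<^sup>2))"
proof -
  define P h u where "P = spatial_factor s x" and "h = hubble s x" and "u = 1 / stereo_denom x"
  define H where "H = S'' / S - h\<^sup>2"
  define w where "w i = conf_grad i x" for i
  have S0: "S \<noteq> 0" using assms by simp
  have spatial_factor: "partial n (spatial_factor s) x = 2 * P * (h * dt n + w n)" for n
    using partial_spatial_factor[OF d1[OF assms(1)] assms(2), of n] by (simp add: P_def h_def w_def)
  have hhp: "partial n (hubble s) x = H * dt n" for n
    using partial_eqI[OF hubble_has_derivative[OF d1[OF assms(1)] assms(2) d2[OF assms(1)]], of n]
    by (simp add: H_def S_def S''_def h_def axis_nth_4 dt_def)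
  have Wp: "partial n (conf_grad k) x = (if n = k then - 2 * spatial k * u else 0) + w n * w k" for n k
    unfolding partial_conf_grad by (simp add: u_def w_def)
  have C: "partial n (rw_christoffel s k i j) x = (if k = 1 then (if i = j then spatial i * (2 * P * (h * dt n + w n) * h + P * H * dt n) else 0)
     else (if j = k then H * dt n * dt i + partial n (conf_grad i) x else 0) + (if i = k then H * dt n * dt j + partial n (conf_grad j) x else 0)
       - (if i = j then spatial i * partial n (conf_grad k) x else 0))" for n k i j
    unfolding rw_christoffel_eq_comb if_distrib[of "\<lambda>f. partial n f x"] partial_christoffel_comb[OF d1[OF assms(1)] assms(2) d2[OF assms(1)]] hhp spatial_factor
    by (auto simp: P_def h_def algebra_simps)
  have w1: "w 1 = 0" by (simp add: w_def conf_grad_def)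
  have ws: "(w 4)\<^sup>2 = 4 * u - 4 * u\<^sup>2 - (w 2)\<^sup>2 - (w 3)\<^sup>2"
  proof -
    have "(x$4)\<^sup>2 = stereo_denom x - 1 - (x$2)\<^sup>2 - (x$3)\<^sup>2" by (simp add: stereo_denom_def)
    then have "(w 4)\<^sup>2 = 4 * (stereo_denom x - 1 - (x$2)\<^sup>2 - (x$3)\<^sup>2) / (stereo_denom x)\<^sup>2"
      by (simp add: w_def conf_grad_def power_divide power_mult_distrib)
    also have "\<dots> = 4 * u - 4 * u\<^sup>2 - (w 2)\<^sup>2 - (w 3)\<^sup>2"
      by (auto simp: u_def w_def conf_grad_def power_divide power_mult_distrib power2_eq_square field_simps)
    finally show ?thesis .
  qed
  have rw_christoffel: "rw_christoffel s k i j x = (if k = 1 then (if i = j then spatial i * (P * h) else 0)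
     else (if j = k then h * dt i + w i else 0) + (if i = k then h * dt j + w j else 0)
       - (if i = j then spatial i * w k else 0))" for k i j
    unfolding rw_christoffel_def P_def h_def w_def ..
  have "ricci (rw_metric s e) x i j = (if i \<noteq> j then 0 else if i = 1 then - 3 * (H + h\<^sup>2)
      else P * (H + 3 * h\<^sup>2) + 8 * u\<^sup>2)"
    using exhaust_4[of i] exhaust_4[of j]
    unfolding ricci_def partial_christoffel[OF assms(1-3)] christoffel_rw_metric[OF assms(3) d1[OF assms(1)] assms(2)]
      sum_4 C rw_christoffel Wp
    apply (elim disjE)
    apply (simp_all add: w1)
    apply (simp_all add: algebra_simps power2_eq_square ws[unfolded power2_eq_square])
    done
  moreover have "S * S'' + 2 * S'\<^sup>2 + 2 = S\<^sup>2 * (H + 3 * h\<^sup>2) + 2"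
    unfolding H_def h_def hubble_def S_def[symmetric] S'_def[symmetric] using S0 
    by (simp add: field_simps power2_eq_square)
  moreover have "P = S\<^sup>2 * (4 * u\<^sup>2)" by (simp add: P_def spatial_factor_def S_def u_def power_divide)
  moreover have "4 / (stereo_denom x)\<^sup>2 = 4 * u\<^sup>2" by (simp add: u_def power_divide)
  ultimately show ?thesis by (simp add: H_def algebra_simps)
qed

lemma scalar_curvature_rw_metric:
  assumes "x $ 1 \<in> I" "s (x $ 1) > 0" "e \<in> {1, -1}"
  defines "S \<equiv> s (x $ 1)" and "S' \<equiv> deriv s (x $ 1)" and "S'' \<equiv> deriv (deriv s) (x $ 1)"
  shows "scalar_curvature (rw_metric s e) x = 6 * (S'' / S + S'\<^sup>2 / S\<^sup>2 + 1 / S\<^sup>2)"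
proof -
  have S0: "S \<noteq> 0" using assms by simp
  show ?thesis
    unfolding scalar_curvature_def sum_4 ricci_rw_metric[OF assms(1-3)] matrix_inv_rw_metric[where s=s, OF assms(3,2)]
     spatial_factor_def S_def[symmetric] S'_def[symmetric] S''_def[symmetric]
    using S0 stereo_denom_nonzero[of x] by (simp add: field_simps eval_nat_numeral)
qed

lemma einstein_equation_iff:
  "einstein_equation I s \<Lambda> m p \<longleftrightarrow> (\<forall>t\<in>I. s t > 0 \<longrightarrow>
     m t = energy_density \<Lambda> s t \<and>
     p t = - 1 / (4 * pi * s t) * (deriv (deriv s) t + 1 / (2 * s t) * ((deriv s t)\<^sup>2 + 1) - \<Lambda> / 2 * s t))"
   (is "_ \<longleftrightarrow> (\<forall>t\<in>I. s t > 0 \<longrightarrow> ?R t)")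
proof -
  have *: "(\<forall>i j. ricci (rw_metric s e) x i j
           + (\<Lambda> - scalar_curvature (rw_metric s e) x / 2) * rw_metric s e x $ i $ j
         = 8 * pi * perfect_fluid s m p e x i j) \<longleftrightarrow> ?R (x $ 1)" if "x $ 1 \<in> I" "s (x $ 1) > 0" "e \<in> {1, -1}" for x e
  proof -
    define S S' S'' where "S = s (x $ 1)" and "S' = deriv s (x $ 1)" and "S'' = deriv (deriv s) (x $ 1)"
    define c where "c = 4 / (stereo_denom x)\<^sup>2"
    have half: "6 * k / 2 = 3 * k" for k :: real by simp
    have c4: "4 * k / (stereo_denom x)\<^sup>2 = c * k" for k by (simp add: c_def)
    have S0: "S \<noteq> 0" "c \<noteq> 0" using that by (simp_all add: S_def c_def)
    have "(\<forall>i j. ricci (rw_metric s e) x i j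
           + (\<Lambda> - scalar_curvature (rw_metric s e) x / 2) * rw_metric s e x $ i $ j
         = 8 * pi * perfect_fluid s m p e x i j) \<longleftrightarrow> 
       - 3 * S'' / S - (\<Lambda> - 3 * (S'' / S + S'\<^sup>2 / S\<^sup>2 + 1 / S\<^sup>2)) = 8 * pi * m (x $ 1) \<and>
       (S * S'' + 2 * S'\<^sup>2 + 2) * c + (\<Lambda> - 3 * (S'' / S + S'\<^sup>2 / S\<^sup>2 + 1 / S\<^sup>2)) * S\<^sup>2 * c = 8 * pi * p (x $ 1) * S\<^sup>2 * c"
      unfolding perfect_fluid_def forall_4 sum_4 ricci_rw_metric[OF that] scalar_curvature_rw_metric[OF that] rw_metric_eq[OF that(3)]
       sphere_metric_eq[OF that(3)] spatial_factor_def S_def[symmetric] S'_def[symmetric] S''_def[symmetric] c_def[symmetric]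
        half by (auto simp: c4 algebra_simps)
    also have "\<dots> \<longleftrightarrow> ?R (x $ 1)"
    proof (intro arg_cong2[where f="(\<and>)"])
      show "(- 3 * S'' / S - (\<Lambda> - 3 * (S'' / S + S'\<^sup>2 / S\<^sup>2 + 1 / S\<^sup>2)) = 8 * pi * m (x $ 1)) = 
         (m (x $ 1) = energy_density \<Lambda> s (x $ 1))"
        unfolding energy_density_def S_def[symmetric] S'_def[symmetric] by (auto simp: field_simps)
      have "(S * S'' + 2 * S'\<^sup>2 + 2) * c + (\<Lambda> - 3 * (S'' / S + S'\<^sup>2 / S\<^sup>2 + 1 / S\<^sup>2)) * S\<^sup>2 * c
         = (\<Lambda> * S\<^sup>2 - 2 * S * S'' - S'\<^sup>2 - 1) * c" using S0 by (simp add: field_simps power2_eq_square)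
      moreover have "8 * pi * (- 1 / (4 * pi * S) * (S'' + 1 / (2 * S) * (S'\<^sup>2 + 1) - \<Lambda> / 2 * S)) * S\<^sup>2 * c
         = (\<Lambda> * S\<^sup>2 - 2 * S * S'' - S'\<^sup>2 - 1) * c" using S0 by (simp add: field_simps power2_eq_square)
      ultimately show "((S * S'' + 2 * S'\<^sup>2 + 2) * c + (\<Lambda> - 3 * (S'' / S + S'\<^sup>2 / S\<^sup>2 + 1 / S\<^sup>2)) * S\<^sup>2 * c = 8 * pi * p (x $ 1) * S\<^sup>2 * c)
         = (p (x $ 1) = - 1 / (4 * pi * s (x$1)) * (deriv (deriv s) (x$1) + 1 / (2 * s (x$1)) * ((deriv s (x$1))\<^sup>2 + 1) - \<Lambda> / 2 * s (x$1)))"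
        unfolding S_def[symmetric] S'_def[symmetric] S''_def[symmetric]
        using S0 by (metis mult_cancel_left mult_cancel_right mult_eq_0_iff pi_neq_zero power_not_zero zero_neq_numeral)
    qed
    finally show ?thesis .
  qed
  show ?thesis
  proof
    assume e: "einstein_equation I s \<Lambda> m p"
    show "\<forall>t\<in>I. s t > 0 \<longrightarrow> ?R t"
    proof (intro ballI impI)
      fix t assume "t \<in> I" "s t > 0"
      then show "?R t" using e *[of "\<chi> i. t" 1] unfolding einstein_equation_def by simp
    qed
  next
    assume "\<forall>t\<in>I. s t > 0 \<longrightarrow> ?R t"
    then show "einstein_equation I s \<Lambda> m p" using * unfolding einstein_equation_def by blast
  qed
qed

end

lemma emeasure_sphere_measure: "emeasure sphere_measure (sphere 0 1) = ennreal (2 * pi\<^sup>2)"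
proof -
  let ?B = "ball 0 1 - {0::real^4}"
  have m: "(\<lambda>x::real^4. x /\<^sub>R norm x) \<in> measurable (restrict_space lborel ?B) (restrict_space borel (sphere 0 1))"
    by (rule measurable_restrict_space3) (auto simp: measurable_lborel1)
  have "emeasure sphere_measure (sphere 0 1) = 4 * emeasure (restrict_space lborel ?B) ((\<lambda>x::real^4. x /\<^sub>R norm x) -` sphere 0 1 \<inter> ?B)"
    unfolding sphere_measure_def
    by (subst emeasure_scale_measure, subst emeasure_distr[OF m]) (auto simp: space_restrict_space sets_restrict_space)
  also have "(\<lambda>x::real^4. x /\<^sub>R norm x) -` sphere 0 1 \<inter> ?B = ?B" by auto
  also have "emeasure (restrict_space lborel ?B) ?B = emeasure lborel ?B"
    by (subst emeasure_restrict_space) auto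
  also have "\<dots> = emeasure lborel (ball (0::real^4) 1)"
    by (rule emeasure_Diff_null_set) auto
  also have "\<dots> = ennreal (pi\<^sup>2 / 2)"
    by (subst emeasure_ball) (simp_all add: unit_ball_vol_4)
  also have "4 * \<dots> = ennreal (2 * pi\<^sup>2)"
    by (simp flip: ennreal_numeral ennreal_mult)
  finally show ?thesis .
qed

end

theory Submission
  imports Defs
begin

text \<open>
  After integration over the sphere the energy is \<open>3\<pi>/4 \<integral> (s s'\<^sup>2 + s - \<Lambda>/3 s\<^sup>3) dt\<close>, whose first
  variation in direction \<open>v\<close> is \<open>3\<pi>/4 \<integral> E v\<close> with \<open>E = 1 - \<Lambda> s\<^sup>2 - s'\<^sup>2 - 2 s s''\<close>, while the volume
  constraint reads \<open>\<integral> s\<^sup>2 v = 0\<close>. The variations \<open>s (1 + \<epsilon> u)\<^sup>1\<^sup>/\<^sup>3\<close> with \<open>\<integral> s\<^sup>3 u = 0\<close> are admissible;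
  taking \<open>u = (t - t0) (t1 - t) (s E - c s\<^sup>3)\<close> with the right constant \<open>c\<close> forces \<open>s E = c s\<^sup>3\<close>, the
  Euler-Lagrange equation multiplied by \<open>s\<close>, and \<open>s (s'\<^sup>2 + a/3 s\<^sup>2 - 1)\<close> is its first integral. At a
  zero of \<open>s\<close> also \<open>s' = 0\<close>, so \<open>2 s s'' + s'\<^sup>2 + a s\<^sup>2 - 1 = -1\<close> there; this excludes zeros of \<open>s\<close>.
\<close>

subsection \<open>Functions of class \<open>C\<^sup>k\<close>\<close>

lemma C_k_on_cong:
  assumes "open S" "C_k_on k S f" "\<And>x. x \<in> S \<Longrightarrow> f x = g x"
  shows "C_k_on k S g"
  using assms(2,3)
proof (induction k arbitrary: f g)
  case 0
  then show ?case by (simp cong: continuous_on_cong)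
next
  case (Suc k)
  have deriv: "frechet_derivative g (at x) = frechet_derivative f (at x)" if "x \<in> S" for x
    using frechet_derivative_transform_within_open[of f x S g] Suc.prems assms(1) that by auto
  have "g differentiable at x" if "x \<in> S" for x
    using Suc.prems that assms(1)
    by (metis C_k_on.simps(2) differentiable_def has_derivative_transform_within_open)
  moreover have "C_k_on k S (\<lambda>x. frechet_derivative g (at x) v)" for v
    by (rule Suc.IH[of "\<lambda>x. frechet_derivative f (at x) v"]) (use Suc.prems deriv in auto)
  ultimately show ?case by simp
qed

text \<open>Lets an explicit derivative formula stand in for \<open>frechet_derivative\<close>; the
  closure properties below are inductions on \<open>k\<close> through this rule.\<close>

lemma C_k_on_SucI:
  assumes "open S" "\<And>x. x \<in> S \<Longrightarrow> (f has_derivative f' x) (at x)" "\<And>v. C_k_on k S (\<lambda>x. f' x v)"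
  shows "C_k_on (Suc k) S f"
proof -
  have "C_k_on k S (\<lambda>x. frechet_derivative f (at x) v)" for v
    using frechet_derivative_at[OF assms(2)] by (intro C_k_on_cong[OF assms(1) assms(3)[of v]]) metis
  then show ?thesis using assms(2) by (auto simp: differentiable_def)
qed

text \<open>The product and chain rules leave undifferentiated factors, for which the induction
  needs one order of differentiability less.\<close>

lemma C_k_on_SucD: "C_k_on (Suc k) S f \<Longrightarrow> C_k_on k S f"
proof (induction k arbitrary: f)
  case 0
  then show ?case
    by (auto intro!: continuous_at_imp_continuous_on differentiable_imp_continuous_within)
next
  case (Suc k)
  then show ?case by (metis C_k_on.simps(2))
qed

lemma C_k_on_has_derivative:
  "C_k_on (Suc k) S f \<Longrightarrow> x \<in> S \<Longrightarrow> (f has_derivative frechet_derivative f (at x)) (at x)"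
  by (simp add: frechet_derivative_works)

lemma C_k_on_subset: "C_k_on k S f \<Longrightarrow> T \<subseteq> S \<Longrightarrow> C_k_on k T f"
  by (induction k arbitrary: f) (auto intro: continuous_on_subset)

lemma C_k_on_const:
  assumes "open S"
  shows "C_k_on k S (\<lambda>x. c)"
proof (induction k arbitrary: c)
  case 0
  show ?case by simp
next
  case (Suc k)
  show ?case
    by (rule C_k_on_SucI[OF assms, where f' = "\<lambda>_ _. 0"]) (auto intro: Suc)
qed

lemma C_k_on_bounded_linear:
  assumes "open S" "bounded_linear f"
  shows "C_k_on k S f"
proof (cases k)
  case 0
  then show ?thesis using assms(2) by (simp add: linear_continuous_on)
next
  case (Suc k')
  show ?thesis unfolding Suc
    by (rule C_k_on_SucI[OF assms(1), where f' = "\<lambda>_. f"])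
      (auto intro: assms C_k_on_const bounded_linear_imp_has_derivative)
qed

lemma C_k_on_add:
  assumes "open S" "C_k_on k S f" "C_k_on k S g"
  shows "C_k_on k S (\<lambda>x. f x + g x)"
  using assms(2,3)
proof (induction k arbitrary: f g)
  case 0
  then show ?case by (auto intro: continuous_intros)
next
  case (Suc k)
  show ?case
    by (rule C_k_on_SucI[OF assms(1) has_derivative_add[OF C_k_on_has_derivative C_k_on_has_derivative]])
      (use Suc in auto)
qed

lemma C_k_on_mult:
  fixes f g :: "'a::real_normed_vector \<Rightarrow> 'b::real_normed_algebra"
  assumes "open S" "C_k_on k S f" "C_k_on k S g"
  shows "C_k_on k S (\<lambda>x. f x * g x)"
  using assms(2,3)
proof (induction k arbitrary: f g)
  case 0
  then show ?case by (auto intro: continuous_intros)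
next
  case (Suc k)
  show ?case
    by (rule C_k_on_SucI[OF assms(1) has_derivative_mult[OF C_k_on_has_derivative C_k_on_has_derivative]])
      (use Suc C_k_on_SucD[of k S f] C_k_on_SucD[of k S g] in \<open>auto intro!: C_k_on_add[OF assms(1)]\<close>)
qed

text \<open>Differentiation lowers the exponent to \<open>a - 1\<close>, so the induction runs over
  all exponents at once.\<close>

lemma C_k_on_powr:
  fixes f :: "'a::real_normed_vector \<Rightarrow> real"
  assumes "open S" "C_k_on k S f" "\<And>x. x \<in> S \<Longrightarrow> f x > 0"
  shows "C_k_on k S (\<lambda>x. f x powr a)"
  using assms(2)
proof (induction k arbitrary: a)
  case 0
  have "f x \<noteq> 0" if "x \<in> S" for x using assms(3)[OF that] by simp
  with 0 show ?case by (simp add: continuous_on_powr)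
next
  case (Suc k)
  have D: "((\<lambda>x. f x powr a) has_derivative (\<lambda>v. a * f x powr (a - 1) * frechet_derivative f (at x) v)) (at x)"
    if "x \<in> S" for x
  proof -
    have "((\<lambda>y. y powr a) has_derivative (\<lambda>h. h * (a * f x powr (a - 1)))) (at (f x))"
      using has_real_derivative_powr[OF assms(3)[OF that], of a]
      by (simp add: has_field_derivative_def mult.commute[of _ "a * f x powr (a - 1)"])
    from has_derivative_compose[OF C_k_on_has_derivative[OF Suc.prems that] this]
    show ?thesis by (simp add: mult_ac)
  qed
  show ?case
    by (rule C_k_on_SucI[OF assms(1) D])
      (use Suc C_k_on_SucD[of k S f] in \<open>auto intro!: C_k_on_mult[OF assms(1)] C_k_on_const[OF assms(1)]\<close>)
qed

text \<open>Lifts functions of time to the plane of pairs (\<epsilon>, t). The directional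
  derivative is again a function of \<open>snd x\<close>, so the induction closes.\<close>

lemma C_k_on_compose_snd:
  assumes "open S" "C_k_on k S f"
  shows "C_k_on k (UNIV \<times> S) (\<lambda>x. f (snd x))"
  using assms(2)
proof (induction k arbitrary: f)
  case 0
  then have "continuous_on S f" by simp
  then have "continuous_on (UNIV \<times> S) (\<lambda>x. f (snd x))"
    by (rule continuous_on_compose2) (auto intro: continuous_on_snd)
  then show ?case by simp
next
  case (Suc k)
  have D: "((\<lambda>x. f (snd x)) has_derivative (\<lambda>v. frechet_derivative f (at (snd x)) (snd v))) (at x)"
    if "x \<in> UNIV \<times> S" for x :: "'c \<times> 'a"
    using that
    by (intro has_derivative_compose[OF has_derivative_snd[OF has_derivative_ident]]
        C_k_on_has_derivative[OF Suc.prems]) auto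
  show ?case
    by (rule C_k_on_SucI[OF _ D]) (use Suc assms(1) in \<open>auto intro: open_Times\<close>)
qed

section \<open>Smooth functions and their partial derivatives\<close>

lemma smooth_on_const: "open S \<Longrightarrow> smooth_on S (\<lambda>x. c)"
  by (simp add: smooth_on_def C_k_on_const)

lemma smooth_on_bounded_linear: "open S \<Longrightarrow> bounded_linear f \<Longrightarrow> smooth_on S f"
  by (simp add: smooth_on_def C_k_on_bounded_linear)

lemma smooth_on_add: "open S \<Longrightarrow> smooth_on S f \<Longrightarrow> smooth_on S g \<Longrightarrow> smooth_on S (\<lambda>x. f x + g x)"
  by (simp add: smooth_on_def C_k_on_add)

lemma smooth_on_mult:
  fixes f g :: "'a::real_normed_vector \<Rightarrow> 'b::real_normed_algebra"
  shows "open S \<Longrightarrow> smooth_on S f \<Longrightarrow> smooth_on S g \<Longrightarrow> smooth_on S (\<lambda>x. f x * g x)"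
  by (simp add: smooth_on_def C_k_on_mult)

lemma smooth_on_powr:
  fixes f :: "'a::real_normed_vector \<Rightarrow> real"
  shows "open S \<Longrightarrow> smooth_on S f \<Longrightarrow> (\<And>x. x \<in> S \<Longrightarrow> f x > 0) \<Longrightarrow> smooth_on S (\<lambda>x. f x powr a)"
  by (simp add: smooth_on_def C_k_on_powr)

lemma smooth_on_compose_snd: "open S \<Longrightarrow> smooth_on S f \<Longrightarrow> smooth_on (UNIV \<times> S) (\<lambda>x. f (snd x))"
  by (simp add: smooth_on_def C_k_on_compose_snd)

lemma smooth_on_subset: "smooth_on S f \<Longrightarrow> T \<subseteq> S \<Longrightarrow> smooth_on T f"
  by (auto simp: smooth_on_def intro: C_k_on_subset)

lemma smooth_on_cong: "open S \<Longrightarrow> smooth_on S f \<Longrightarrow> (\<And>x. x \<in> S \<Longrightarrow> f x = g x) \<Longrightarrow> smooth_on S g"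
  unfolding smooth_on_def by (blast intro: C_k_on_cong)

lemma smooth_on_has_derivative:
  "smooth_on S f \<Longrightarrow> x \<in> S \<Longrightarrow> (f has_derivative frechet_derivative f (at x)) (at x)"
  unfolding smooth_on_def by (blast intro: C_k_on_has_derivative)

lemma smooth_on_frechet_derivative: "smooth_on S f \<Longrightarrow> smooth_on S (\<lambda>x. frechet_derivative f (at x) v)"
  unfolding smooth_on_def by (metis C_k_on.simps(2))

lemma smooth_on_imp_continuous_on: "smooth_on S f \<Longrightarrow> continuous_on S f"
  unfolding smooth_on_def by (metis C_k_on.simps(1))

lemma smooth_on_has_real_derivative:
  fixes f :: "real \<Rightarrow> real"
  assumes "smooth_on S f" "x \<in> S"
  shows "(f has_real_derivative deriv f x) (at x)"
  using smooth_on_has_derivative[OF assms]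
  by (metis DERIV_deriv_iff_real_differentiable differentiable_def)

lemma smooth_on_deriv:
  fixes f :: "real \<Rightarrow> real"
  assumes "open S" "smooth_on S f"
  shows "smooth_on S (deriv f)"
proof (rule smooth_on_cong[OF assms(1) smooth_on_frechet_derivative[OF assms(2), of 1]])
  fix x assume "x \<in> S"
  from smooth_on_has_real_derivative[OF assms(2) this]
  show "frechet_derivative f (at x) 1 = deriv f x"
    using frechet_derivative_at[of f "(*) (deriv f x)" x] by (metis has_field_derivative_def mult.right_neutral)
qed

text \<open>Writes a partial derivative as a directional Frechet derivative, whose joint smoothness
  is already known from \<open>smooth_on_frechet_derivative\<close>.\<close>

lemma smooth_on_has_real_derivative_fst:
  fixes F :: "real \<times> real \<Rightarrow> real"
  assumes "smooth_on S F" "(a, b) \<in> S"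
  shows "((\<lambda>x. F (x, b)) has_real_derivative frechet_derivative F (at (a, b)) (1, 0)) (at a)"
proof -
  have D: "(F has_derivative frechet_derivative F (at (a, b))) (at (a, b))"
    using assms by (rule smooth_on_has_derivative)
  then interpret bounded_linear "frechet_derivative F (at (a, b))" by (rule has_derivative_bounded_linear)
  have "((\<lambda>x. F (x, b)) has_derivative (\<lambda>h. frechet_derivative F (at (a, b)) (h, 0))) (at a)"
    by (rule has_derivative_compose[of "\<lambda>x. (x, b)" "\<lambda>h. (h, 0)", OF _ D])
      (intro has_derivative_Pair has_derivative_ident has_derivative_const)
  moreover have "(\<lambda>h. frechet_derivative F (at (a, b)) (h, 0)) = (*) (frechet_derivative F (at (a, b)) (1, 0))"
  proof
    show "frechet_derivative F (at (a, b)) (h, 0) = frechet_derivative F (at (a, b)) (1, 0) * h" for h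
      using scaleR[of h "(1, 0)"] by simp
  qed
  ultimately show ?thesis by (simp only: has_field_derivative_def)
qed

lemma smooth_on_has_real_derivative_snd:
  fixes F :: "real \<times> real \<Rightarrow> real"
  assumes "smooth_on S F" "(a, b) \<in> S"
  shows "((\<lambda>y. F (a, y)) has_real_derivative frechet_derivative F (at (a, b)) (0, 1)) (at b)"
proof -
  have D: "(F has_derivative frechet_derivative F (at (a, b))) (at (a, b))"
    using assms by (rule smooth_on_has_derivative)
  then interpret bounded_linear "frechet_derivative F (at (a, b))" by (rule has_derivative_bounded_linear)
  have "((\<lambda>y. F (a, y)) has_derivative (\<lambda>h. frechet_derivative F (at (a, b)) (0, h))) (at b)"
    by (rule has_derivative_compose[of "\<lambda>y. (a, y)" "\<lambda>h. (0, h)", OF _ D])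
      (intro has_derivative_Pair has_derivative_ident has_derivative_const)
  moreover have "(\<lambda>h. frechet_derivative F (at (a, b)) (0, h)) = (*) (frechet_derivative F (at (a, b)) (0, 1))"
  proof
    show "frechet_derivative F (at (a, b)) (0, h) = frechet_derivative F (at (a, b)) (0, 1) * h" for h
      using scaleR[of h "(0, 1)"] by simp
  qed
  ultimately show ?thesis by (simp only: has_field_derivative_def)
qed

subsection \<open>Total energy and its first variation\<close>

lemma space_sphere_measure [simp]: "space sphere_measure = sphere 0 1"
  by (simp add: sphere_measure_def space_scale_measure space_restrict_space)

lemma finite_measure_sphere_measure: "finite_measure sphere_measure"
  by (rule finite_measureI) (simp add: emeasure_sphere_measure)

text \<open>The integrand depends on time only, so Fubini splits off the total mass 2 pi^2 of the
  sphere.\<close>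

lemma total_energy_eq_integral:
  assumes "continuous_on {t0..t1} (\<lambda>t. energy_density \<Lambda> f t * f t ^ 3)"
  shows "total_energy \<Lambda> f t0 t1 = 2 * pi\<^sup>2 * integral {t0..t1} (\<lambda>t. energy_density \<Lambda> f t * f t ^ 3)"
proof -
  interpret sphere: finite_measure sphere_measure by (rule finite_measure_sphere_measure)
  interpret P: pair_sigma_finite lborel sphere_measure ..
  define g where "g = (\<lambda>t. indicat_real {t0..t1} t * (energy_density \<Lambda> f t * f t ^ 3))"
  have int: "set_integrable lborel {t0..t1} (\<lambda>t. energy_density \<Lambda> f t * f t ^ 3)"
    using assms by (rule borel_integrable_atLeastAtMost')
  then have g: "integrable lborel g"
    by (simp add: set_integrable_def g_def)
  then have [measurable]: "g \<in> borel_measurable lborel" by auto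
  have "total_energy \<Lambda> f t0 t1 = (\<integral>z. g (fst z) \<partial>(lborel \<Otimes>\<^sub>M sphere_measure))"
    unfolding total_energy_def set_lebesgue_integral_def
    by (rule Bochner_Integration.integral_cong) (auto simp: space_pair_measure g_def indicator_def)
  also have "\<dots> = (\<integral>t. (\<integral>y. g (fst (t, y)) \<partial>sphere_measure) \<partial>lborel)"
    by (rule P.integral_fst'[symmetric], rule P.Fubini_integrable)
      (use g in \<open>auto intro!: integrable_mult_right integrable_norm\<close>)
  also have "\<dots> = (\<integral>t. 2 * pi\<^sup>2 * g t \<partial>lborel)"
    using emeasure_sphere_measure by (simp add: measure_def)
  also have "\<dots> = 2 * pi\<^sup>2 * (LINT t : {t0..t1} | lborel. energy_density \<Lambda> f t * f t ^ 3)"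
    by (simp add: g_def set_lebesgue_integral_def)
  finally show ?thesis using set_borel_integral_eq_integral(2)[OF int] by simp
qed

text \<open>The volume factor cancels the denominators. At a zero of \<open>f\<close> both sides
  vanish, so the energy is the integral of a polynomial Lagrangian even where a variation touches
  0.\<close>

lemma energy_density_times_cube:
  "energy_density \<Lambda> f t * f t ^ 3 =
     3 / (8 * pi) * (f t * (deriv f t)\<^sup>2 + f t - \<Lambda> / 3 * f t ^ 3)"
  by (cases "f t = 0") (auto simp: energy_density_def field_simps eval_nat_numeral)

lemma leibniz_rule_at_0:
  fixes f fx :: "real \<Rightarrow> real \<Rightarrow> real"
  assumes "\<delta> > 0"
    and "\<And>x t. x \<in> {-\<delta><..<\<delta>} \<Longrightarrow> t \<in> {a..b} \<Longrightarrow> ((\<lambda>x. f x t) has_real_derivative fx x t) (at x)"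
    and "\<And>x. x \<in> {-\<delta><..<\<delta>} \<Longrightarrow> continuous_on {a..b} (f x)"
    and "continuous_on ({-\<delta><..<\<delta>} \<times> {a..b}) (\<lambda>(x, t). fx x t)"
  shows "((\<lambda>x. integral {a..b} (f x)) has_real_derivative integral {a..b} (fx 0)) (at 0)"
proof -
  have "((\<lambda>x. integral (cbox a b) (f x)) has_real_derivative integral (cbox a b) (fx 0))
          (at 0 within {-\<delta><..<\<delta>})"
  proof (rule leibniz_rule_field_derivative)
    show "((\<lambda>x. f x t) has_real_derivative fx x t) (at x within {-\<delta><..<\<delta>})"
      if "x \<in> {-\<delta><..<\<delta>}" "t \<in> cbox a b" for x t
      using assms(2)[of x t] that by (simp add: has_field_derivative_at_within)
    show "f x integrable_on cbox a b" if "x \<in> {-\<delta><..<\<delta>}" for x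
      using assms(3)[OF that] by (simp add: integrable_continuous_real)
  qed (use assms(1,4) in auto)
  then show ?thesis using assms(1) by (simp add: at_within_open[of 0 "{-\<delta><..<\<delta>}"])
qed

context
  fixes s :: "real \<Rightarrow> real" and I :: "real set" and t0 t1 \<delta> :: real and F :: "real \<times> real \<Rightarrow> real"
  assumes s: "open I" "smooth_on I s" and t: "t0 < t1" "{t0..t1} \<subseteq> I"
    and F: "admissible_variation s t0 t1 \<delta> F"
begin

text \<open>
  For each fixed \<open>\<epsilon>\<close> the \<open>\<epsilon>\<close>-independent factor \<open>2 s s'\<close> is integrated by parts before
  differentiating in \<open>\<epsilon>\<close>, so that the symmetry of mixed second derivatives is not needed.
\<close>

lemma first_variation:
  defines "v \<equiv> \<lambda>t. frechet_derivative F (at (0, t)) (1, 0)"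
  shows "((\<lambda>\<epsilon>. total_energy \<Lambda> (\<lambda>t. F (\<epsilon>, t)) t0 t1) has_real_derivative
      3 * pi / 4 * integral {t0..t1}
        (\<lambda>t. (1 - \<Lambda> * (s t)\<^sup>2 - (deriv s t)\<^sup>2 - 2 * s t * deriv (deriv s) t) * v t)) (at 0)" (is ?energy)
    and "integral {t0..t1} (\<lambda>t. (s t)\<^sup>2 * v t) = 0" (is ?volume)
    and "continuous_on {t0..t1} v"
proof -
  from F obtain \<eta> where \<eta>: "\<eta> > 0" "smooth_on ({-\<delta><..<\<delta>} \<times> {t0-\<eta><..<t1+\<eta>}) F"
    and \<delta>: "\<delta> > 0"
    and F0: "\<And>t. t \<in> {t0..t1} \<Longrightarrow> F (0, t) = s t"
    and Fend: "\<And>\<epsilon>. \<epsilon> \<in> {-\<delta><..<\<delta>} \<Longrightarrow> F (\<epsilon>, t0) = s t0 \<and> F (\<epsilon>, t1) = s t1"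
    and Fvol: "\<And>\<epsilon>. \<epsilon> \<in> {-\<delta><..<\<delta>} \<Longrightarrow>
       integral {t0..t1} (\<lambda>t. F (\<epsilon>, t) ^ 3) = integral {t0..t1} (\<lambda>t. s t ^ 3)"
    unfolding admissible_variation_def by blast
  \<comment> \<open>\<open>S\<close> is open and carries the smoothness of \<open>F\<close>;
    \<open>R\<close> is the part of it, closed in time, over which integrals are taken.\<close>
  define S where "S = {-\<delta><..<\<delta>} \<times> {t0-\<eta><..<t1+\<eta>}"
  define R where "R = {-\<delta><..<\<delta>} \<times> {t0..t1}"
  have RS: "R \<subseteq> S" using \<eta> by (auto simp: R_def S_def)
  have mem: "(\<epsilon>, t) \<in> S" if "\<epsilon> \<in> {-\<delta><..<\<delta>}" "t \<in> {t0..t1}" for \<epsilon> t using that \<eta> by (auto simp: S_def)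
  have z: "0 \<in> {-\<delta><..<\<delta>}" using \<delta> by simp
  \<comment> \<open>Index 1 stands for \<epsilon> and 2 for t; in \<open>F21\<close> the time
    derivative is taken first.\<close>
  define F1 where "F1 = (\<lambda>x. frechet_derivative F (at x) (1, 0))"
  define F2 where "F2 = (\<lambda>x. frechet_derivative F (at x) (0, 1))"
  define F21 where "F21 = (\<lambda>x. frechet_derivative F2 (at x) (1, 0))"
  have sm: "smooth_on S F" "smooth_on S F1" "smooth_on S F2" "smooth_on S F21"
    using \<eta>(2) by (simp_all add: S_def F1_def F2_def F21_def smooth_on_frechet_derivative)
  note cont [continuous_intros] = sm[THEN smooth_on_imp_continuous_on, THEN continuous_on_subset, OF RS]
  have slice: "continuous_on {t0..t1} (\<lambda>t. G (\<epsilon>, t))" if "continuous_on R G" "\<epsilon> \<in> {-\<delta><..<\<delta>}"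
    for G :: "real \<times> real \<Rightarrow> real" and \<epsilon>
    by (rule continuous_on_compose2[OF that(1)]) (use that in \<open>auto simp: R_def intro!: continuous_intros\<close>)
  note slices [continuous_intros] = cont[THEN slice]
  have dF: "((\<lambda>\<epsilon>. F (\<epsilon>, t)) has_real_derivative F1 (\<epsilon>, t)) (at \<epsilon>)"
    "((\<lambda>\<epsilon>. F2 (\<epsilon>, t)) has_real_derivative F21 (\<epsilon>, t)) (at \<epsilon>)"
    "((\<lambda>t. F (\<epsilon>, t)) has_real_derivative F2 (\<epsilon>, t)) (at t)"
    if "\<epsilon> \<in> {-\<delta><..<\<delta>}" "t \<in> {t0..t1}" for \<epsilon> t
    unfolding F21_def
    using smooth_on_has_real_derivative_fst[OF sm(1) mem[OF that]]
      smooth_on_has_real_derivative_fst[OF sm(3) mem[OF that]]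
      smooth_on_has_real_derivative_snd[OF sm(1) mem[OF that]]
    by (simp_all add: F1_def F2_def)
  have v: "v t = F1 (0, t)" for t by (simp add: v_def F1_def)
  show contv: "continuous_on {t0..t1} v"
    unfolding v[abs_def] using z by (intro continuous_intros)
  have sI: "t \<in> I" if "t \<in> {t0..t1}" for t using that t by auto
  have ds: "(s has_real_derivative deriv s t) (at t)"
    "(deriv s has_real_derivative deriv (deriv s) t) (at t)" if "t \<in> {t0..t1}" for t
    using smooth_on_has_real_derivative[OF s(2) sI[OF that]]
      smooth_on_has_real_derivative[OF smooth_on_deriv[OF s] sI[OF that]] by auto
  note [continuous_intros] = s(2)[THEN smooth_on_imp_continuous_on, THEN continuous_on_subset, OF t(2)]
     smooth_on_deriv[OF s, THEN smooth_on_imp_continuous_on, THEN continuous_on_subset, OF t(2)]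
     smooth_on_deriv[OF s(1) smooth_on_deriv[OF s], THEN smooth_on_imp_continuous_on, THEN continuous_on_subset, OF t(2)]
  \<comment> \<open>\<open>F (0, t)\<close> is known to equal \<open>s t\<close> only on the closed
    interval, so the derivatives are compared within it; this covers the endpoints, where they are
    one-sided.\<close>
  have F20: "F2 (0, t) = deriv s t" if "t \<in> {t0..t1}" for t
  proof -
    have "((\<lambda>t. F (0, t)) has_vector_derivative F2 (0, t)) (at t within cbox t0 t1)"
      using dF(3)[OF z that] by (simp add: has_real_derivative_iff_has_vector_derivative has_vector_derivative_at_within)
    then have "(s has_vector_derivative F2 (0, t)) (at t within cbox t0 t1)"
      by (rule has_vector_derivative_transform[rotated 2]) (use that F0 in auto)
    moreover have "(s has_vector_derivative deriv s t) (at t within cbox t0 t1)"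
      using ds(1)[OF that] by (simp add: has_real_derivative_iff_has_vector_derivative has_vector_derivative_at_within)
    ultimately show ?thesis
      using vector_derivative_unique_within_closed_interval[of t0 t1 t] t(1) that by auto
  qed

  \<comment> \<open>The volume is constant in \<epsilon>, so its derivative under the integral sign
    must vanish.\<close>
  have "((\<lambda>\<epsilon>. integral {t0..t1} (\<lambda>t. F (\<epsilon>, t) ^ 3)) has_real_derivative
      integral {t0..t1} (\<lambda>t. 3 * F (0, t) ^ 2 * F1 (0, t))) (at 0)"
    by (rule leibniz_rule_at_0[OF \<delta>, where fx = "\<lambda>\<epsilon> t. 3 * F (\<epsilon>, t) ^ 2 * F1 (\<epsilon>, t)"])
      (auto simp: case_prod_unfold R_def[symmetric] intro!: continuous_intros derivative_eq_intros dF(1))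
  moreover have "((\<lambda>\<epsilon>. integral {t0..t1} (\<lambda>t. F (\<epsilon>, t) ^ 3)) has_real_derivative 0) (at 0)"
    by (rule has_field_derivative_transform_within_open[of "\<lambda>_. integral {t0..t1} (\<lambda>t. s t ^ 3)" _ _ "{-\<delta><..<\<delta>}"])
      (use z Fvol in auto)
  ultimately have "integral {t0..t1} (\<lambda>t. 3 * F (0, t) ^ 2 * F1 (0, t)) = 0"
    by (rule DERIV_unique)
  also have "integral {t0..t1} (\<lambda>t. 3 * F (0, t) ^ 2 * F1 (0, t)) = integral {t0..t1} (\<lambda>t. 3 * ((s t)\<^sup>2 * v t))"
    by (rule Henstock_Kurzweil_Integration.integral_cong) (simp add: F0 v)
  finally show ?volume by simp

  \<comment> \<open>\<open>P\<close> is the momentum 2 s s', the derivative of the Lagrangian in s',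
    and \<open>P'\<close> is its time derivative.\<close>
  define P where "P = (\<lambda>t. 2 * s t * deriv s t)"
  define P' where "P' = (\<lambda>t. 2 * (deriv s t)\<^sup>2 + 2 * s t * deriv (deriv s) t)"
  have dP: "(P has_real_derivative P' t) (at t)" if "t \<in> {t0..t1}" for t
    unfolding P_def P'_def using ds[OF that]
    by (auto intro!: derivative_eq_intros simp: power2_eq_square algebra_simps)
  have contP [continuous_intros]: "continuous_on {t0..t1} P" "continuous_on {t0..t1} P'"
    unfolding P_def P'_def by (auto intro!: continuous_intros)
  have contP2 [continuous_intros]: "continuous_on R (\<lambda>x. P (snd x))" "continuous_on R (\<lambda>x. P' (snd x))"
    by (rule continuous_on_compose2[OF contP(1)] continuous_on_compose2[OF contP(2)];
        auto simp: R_def intro!: continuous_intros)+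
  have "((\<lambda>\<epsilon>. integral {t0..t1} (\<lambda>t. P t * F2 (\<epsilon>, t) + P' t * F (\<epsilon>, t))) has_real_derivative
      integral {t0..t1} (\<lambda>t. P t * F21 (0, t) + P' t * F1 (0, t))) (at 0)"
    by (rule leibniz_rule_at_0[OF \<delta>, where fx = "\<lambda>\<epsilon> t. P t * F21 (\<epsilon>, t) + P' t * F1 (\<epsilon>, t)"])
      (auto simp: case_prod_unfold R_def[symmetric] intro!: continuous_intros derivative_eq_intros dF)
  \<comment> \<open>The integrand is the time derivative of P F(\<epsilon>, t). Its integral sees
    only the endpoint values of \<open>F\<close>, which the variation fixes.\<close>
  moreover have parts: "integral {t0..t1} (\<lambda>t. P t * F2 (\<epsilon>, t) + P' t * F (\<epsilon>, t)) = P t1 * s t1 - P t0 * s t0"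
    if "\<epsilon> \<in> {-\<delta><..<\<delta>}" for \<epsilon>
  proof -
    have "((\<lambda>t. P t * F2 (\<epsilon>, t) + P' t * F (\<epsilon>, t)) has_integral (P t1 * F (\<epsilon>, t1) - P t0 * F (\<epsilon>, t0))) {t0..t1}"
    proof (rule fundamental_theorem_of_calculus)
      show "((\<lambda>t. P t * F (\<epsilon>, t)) has_vector_derivative P t * F2 (\<epsilon>, t) + P' t * F (\<epsilon>, t))
          (at t within {t0..t1})" if t: "t \<in> {t0..t1}" for t
        using DERIV_mult[OF dP[OF t] dF(3)[OF \<open>\<epsilon> \<in> _\<close> t]]
        by (simp add: has_real_derivative_iff_has_vector_derivative has_vector_derivative_at_within
            add.commute mult.commute)
    qed (use t(1) in simp)
    then show ?thesis using Fend[OF that] by (simp add: integral_unique)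
  qed
  have "((\<lambda>\<epsilon>. integral {t0..t1} (\<lambda>t. P t * F2 (\<epsilon>, t) + P' t * F (\<epsilon>, t))) has_real_derivative 0) (at 0)"
    by (rule has_field_derivative_transform_within_open[of "\<lambda>_. P t1 * s t1 - P t0 * s t0" _ _ "{-\<delta><..<\<delta>}"])
      (use z parts in auto)
  ultimately have by_parts: "integral {t0..t1} (\<lambda>t. P t * F21 (0, t) + P' t * F1 (0, t)) = 0"
    by (rule DERIV_unique)

  define L where "L = (\<lambda>\<epsilon> t. F (\<epsilon>, t) * (F2 (\<epsilon>, t))\<^sup>2 + F (\<epsilon>, t) - \<Lambda> / 3 * F (\<epsilon>, t) ^ 3)"
  define L' where "L' = (\<lambda>\<epsilon> t. F1 (\<epsilon>, t) * (F2 (\<epsilon>, t))\<^sup>2 + 2 * F (\<epsilon>, t) * F2 (\<epsilon>, t) * F21 (\<epsilon>, t)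
     + F1 (\<epsilon>, t) - \<Lambda> * (F (\<epsilon>, t))\<^sup>2 * F1 (\<epsilon>, t))"
  define E where "E = (\<lambda>t. 1 - \<Lambda> * (s t)\<^sup>2 - (deriv s t)\<^sup>2 - 2 * s t * deriv (deriv s) t)"
  have contL: "continuous_on {t0..t1} (L \<epsilon>)" if "\<epsilon> \<in> {-\<delta><..<\<delta>}" for \<epsilon>
    unfolding L_def using that by (auto intro!: continuous_intros)
  have "((\<lambda>\<epsilon>. integral {t0..t1} (L \<epsilon>)) has_real_derivative integral {t0..t1} (L' 0)) (at 0)"
  proof (rule leibniz_rule_at_0[OF \<delta>, where fx = L'])
    show "((\<lambda>\<epsilon>. L \<epsilon> t) has_real_derivative L' \<epsilon> t) (at \<epsilon>)" if "\<epsilon> \<in> {-\<delta><..<\<delta>}" "t \<in> {t0..t1}" for \<epsilon> t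
      unfolding L_def L'_def using that
      by (auto intro!: derivative_eq_intros dF simp: algebra_simps power2_eq_square)
    show "continuous_on ({-\<delta><..<\<delta>} \<times> {t0..t1}) (\<lambda>(\<epsilon>, t). L' \<epsilon> t)"
      unfolding L'_def by (auto simp: case_prod_unfold R_def[symmetric] intro!: continuous_intros)
  qed (rule contL)
  \<comment> \<open>The constant is 2 pi^2, the volume of the sphere, times 3 / (8 pi).\<close>
  then have "((\<lambda>\<epsilon>. 3 * pi / 4 * integral {t0..t1} (L \<epsilon>)) has_real_derivative 3 * pi / 4 * integral {t0..t1} (L' 0)) (at 0)"
    by (rule DERIV_cmult)
  then have "((\<lambda>\<epsilon>. total_energy \<Lambda> (\<lambda>t. F (\<epsilon>, t)) t0 t1) has_real_derivative 3 * pi / 4 * integral {t0..t1} (L' 0)) (at 0)"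
  proof (rule has_field_derivative_transform_within_open[where S = "{-\<delta><..<\<delta>}"])
    fix \<epsilon> assume e: "\<epsilon> \<in> {-\<delta><..<\<delta>}"
    have eq: "energy_density \<Lambda> (\<lambda>t. F (\<epsilon>, t)) t * F (\<epsilon>, t) ^ 3 = 3 / (8 * pi) * L \<epsilon> t" if "t \<in> {t0..t1}" for t
      using energy_density_times_cube[of \<Lambda> "\<lambda>t. F (\<epsilon>, t)" t]
      unfolding DERIV_imp_deriv[OF dF(3)[OF e that]] L_def .
    have "continuous_on {t0..t1} (\<lambda>t. 3 / (8 * pi) * L \<epsilon> t)"
      by (intro continuous_intros contL e)
    then have "continuous_on {t0..t1} (\<lambda>t. energy_density \<Lambda> (\<lambda>t. F (\<epsilon>, t)) t * F (\<epsilon>, t) ^ 3)"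
      by (rule continuous_on_eq) (simp only: eq)
    from total_energy_eq_integral[OF this]
    have "total_energy \<Lambda> (\<lambda>t. F (\<epsilon>, t)) t0 t1 = 2 * pi\<^sup>2 * integral {t0..t1} (\<lambda>t. 3 / (8 * pi) * L \<epsilon> t)"
      using Henstock_Kurzweil_Integration.integral_cong[OF eq, of "{t0..t1}"] by simp
    then show "3 * pi / 4 * integral {t0..t1} (L \<epsilon>) = total_energy \<Lambda> (\<lambda>t. F (\<epsilon>, t)) t0 t1"
      by (simp add: power2_eq_square)
  qed (use z in auto)
  \<comment> \<open>Adding and subtracting \<open>P' t * v t\<close> isolates
    \<open>E t * v t\<close>; the remaining bracket integrates to 0 by
    \<open>by_parts\<close>.\<close>
  also have "integral {t0..t1} (L' 0) = integral {t0..t1} (\<lambda>t. E t * v t + (P t * F21 (0, t) + P' t * F1 (0, t)))"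
    by (rule Henstock_Kurzweil_Integration.integral_cong)
      (simp add: L'_def E_def P_def P'_def F0 F20 v algebra_simps power2_eq_square)
  also have "\<dots> = integral {t0..t1} (\<lambda>t. E t * v t) + integral {t0..t1} (\<lambda>t. P t * F21 (0, t) + P' t * F1 (0, t))"
    by (rule integral_add; rule integrable_continuous_real)
      (use z contv in \<open>auto simp: E_def intro!: continuous_intros\<close>)
  finally show ?energy using by_parts by (simp add: E_def)
qed

end

subsection \<open>The Euler-Lagrange equation and its first integral\<close>

text \<open>The level set through \<open>a\<close> is closed by continuity and open by local
  constancy. Local constancy is asked at this one level, so that a nonzero level of
  \<open>euler_lagrange\<close> can be treated separately.\<close>

lemma connected_locally_constant_level_set:
  fixes f :: "'a::topological_space \<Rightarrow> 'b::t1_space"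
  assumes "connected S" "open S" "continuous_on S f" "a \<in> S" "b \<in> S"
    and "\<And>x. x \<in> S \<Longrightarrow> f x = f a \<Longrightarrow> \<exists>T. open T \<and> x \<in> T \<and> (\<forall>y\<in>T \<inter> S. f y = f a)"
  shows "f b = f a"
proof -
  let ?A = "{x \<in> S. f x = f a}"
  have "open ?A" 
  proof (subst open_subopen, intro ballI)
    fix x assume "x \<in> ?A"
    then obtain T where "open T" "x \<in> T" "\<forall>y\<in>T \<inter> S. f y = f a" using assms(6) by auto
    then show "\<exists>T. open T \<and> x \<in> T \<and> T \<subseteq> ?A"
      using assms(2) \<open>x \<in> ?A\<close> by (intro exI[of _ "T \<inter> S"]) auto
  qed
  then have "openin (top_of_set S) ?A" by (auto intro: open_subset)
  moreover have "closedin (top_of_set S) ?A"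
    using continuous_closedin_preimage_constant[OF assms(3), of "f a"] by simp
  ultimately have "?A = S" using assms(1,4) unfolding connected_clopen by blast
  then show ?thesis using assms(5) by blast
qed

text \<open>This is d/dt (dL/ds') - dL/ds for the Lagrangian L = s (s'^2 - a/3 s^2 + 1).\<close>

definition euler_lagrange :: "(real \<Rightarrow> real) \<Rightarrow> real \<Rightarrow> real \<Rightarrow> real" where
  "euler_lagrange s a t = 2 * s t * deriv (deriv s) t + (deriv s t)\<^sup>2 + a * (s t)\<^sup>2 - 1"

context
  fixes s :: "real \<Rightarrow> real" and I :: "real set"
  assumes I: "open I" "is_interval I" and smooth: "smooth_on I s"
    and nonneg: "\<And>t. t \<in> I \<Longrightarrow> s t \<ge> 0" and nonconst: "\<not> s constant_on I"
begin

lemma scale_has_derivs: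
  assumes "t \<in> I"
  shows "(s has_real_derivative deriv s t) (at t)"
    "(deriv s has_real_derivative deriv (deriv s) t) (at t)"
  using smooth_on_has_real_derivative[OF smooth assms]
    smooth_on_has_real_derivative[OF smooth_on_deriv[OF I(1) smooth] assms] by auto

lemma continuous_on_scale_derivs:
  "continuous_on I s" "continuous_on I (deriv s)" "continuous_on I (deriv (deriv s))"
  by (intro smooth_on_imp_continuous_on smooth_on_deriv I smooth)+

text \<open>A zero of a nonnegative function is an interior minimum.\<close>

lemma deriv_scale_eq_0:
  assumes "t \<in> I" "s t = 0"
  shows "deriv s t = 0"
proof -
  obtain d where "d > 0" "ball t d \<subseteq> I" using I(1) assms(1) open_contains_ball by blast
  then show ?thesis
    using scale_has_derivs(1)[OF assms(1)] nonneg assms(2)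
    by (intro DERIV_local_min[of s _ t d]) (auto simp: dist_real_def subset_iff)
qed

lemma continuous_on_euler_lagrange: "continuous_on I (euler_lagrange s a)"
  unfolding euler_lagrange_def by (intro continuous_intros continuous_on_scale_derivs)

text \<open>The differentiated function is the energy s' dL/ds' - L of the Lagrangian, conserved
  along solutions because L does not depend on time.\<close>

lemma first_integral_has_derivative:
  assumes "t \<in> I"
  shows "((\<lambda>t. s t * ((deriv s t)\<^sup>2 + a / 3 * (s t)\<^sup>2 - 1)) has_real_derivative deriv s t * euler_lagrange s a t) (at t)"
  using scale_has_derivs[OF assms]
  by (auto intro!: derivative_eq_intros simp: euler_lagrange_def algebra_simps power2_eq_square)

lemma euler_lagrange_eq_0_imp_internal_parameters:
  assumes "\<And>t. t \<in> I \<Longrightarrow> euler_lagrange s a t = 0"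
  shows "\<exists>H. internal_parameters I s a H"
proof -
  let ?f = "\<lambda>t. s t * ((deriv s t)\<^sup>2 + a / 3 * (s t)\<^sup>2 - 1)"
  have "?f constant_on I"
    using first_integral_has_derivative[where a=a] assms I
    by (intro has_field_derivative_0_imp_constant_on) (auto simp: is_interval_connected_1)
  then show ?thesis by (auto simp: constant_on_def internal_parameters_def)
qed

text \<open>
  The first integral yields only \<open>s' * euler_lagrange s a = 0\<close>. Where \<open>euler_lagrange s a\<close> is nonzero, \<open>s\<close> is locally
  constant, hence so is \<open>euler_lagrange s a\<close>; thus nonzero level sets of \<open>euler_lagrange s a\<close> are open and closed in \<open>I\<close>.
\<close>

lemma internal_parameters_imp_euler_lagrange_eq_0:
  assumes "internal_parameters I s a H" "t \<in> I"
  shows "euler_lagrange s a t = 0"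
proof (rule ccontr)
  assume nz: "euler_lagrange s a t \<noteq> 0"
  \<comment> \<open>\<open>internal_parameters\<close> speaks only where \<open>s\<close> is
    positive. This is an open set, so the first integral has derivative 0 there; at a zero of
    \<open>s\<close> the factor s' vanishes.\<close>
  have *: "deriv s u * euler_lagrange s a u = 0" if u: "u \<in> I" for u
  proof (cases "s u = 0")
    case True
    then show ?thesis using deriv_scale_eq_0 u by simp
  next
    case False
    then have "s u > 0" using nonneg u by force
    have "((\<lambda>t. s t * ((deriv s t)\<^sup>2 + a / 3 * (s t)\<^sup>2 - 1)) has_real_derivative 0) (at u)"
    proof (rule has_field_derivative_transform_within_open)
      show "open (I \<inter> s -` {0<..})"
        by (intro continuous_open_preimage continuous_on_scale_derivs I(1) open_greaterThan)
      show "H = s w * ((deriv s w)\<^sup>2 + a / 3 * (s w)\<^sup>2 - 1)" if "w \<in> I \<inter> s -` {0<..}" for w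
        using assms(1) that by (simp only: internal_parameters_def) auto
    qed (use u \<open>s u > 0\<close> in auto)
    then show ?thesis using first_integral_has_derivative[OF u, of a] DERIV_unique by blast
  qed
  have el: "euler_lagrange s a u = euler_lagrange s a t" if "u \<in> I" for u
  proof (rule connected_locally_constant_level_set[of I "euler_lagrange s a" t u])
    fix x assume x: "x \<in> I" "euler_lagrange s a x = euler_lagrange s a t"
    have "open (I \<inter> euler_lagrange s a -` (- {0}))"
      by (intro continuous_open_preimage continuous_on_euler_lagrange I(1) open_Compl closed_singleton)
    moreover have "x \<in> I \<inter> euler_lagrange s a -` (- {0})" using x nz by simp
    ultimately obtain d where d: "d > 0" "ball x d \<subseteq> I \<inter> euler_lagrange s a -` (- {0})"
      by (rule openE)
    have s': "deriv s u = 0" if "u \<in> ball x d" for u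
    proof -
      have "u \<in> I" "euler_lagrange s a u \<noteq> 0" using d(2) that by blast+
      then show ?thesis using *[of u] by simp
    qed
    have s'': "deriv (deriv s) u = 0" if "u \<in> ball x d" for u
    proof -
      have "(deriv s has_real_derivative 0) (at u)"
        by (rule has_field_derivative_transform_within_open[of "\<lambda>_. 0" 0 u "ball x d"]) (use s' that in auto)
      then show ?thesis by (rule DERIV_imp_deriv)
    qed
    have "s constant_on ball x d"
    proof (rule has_field_derivative_0_imp_constant_on)
      show "(s has_real_derivative 0) (at w)" if "w \<in> ball x d" for w
        using scale_has_derivs(1)[of w] s'[OF that] d that by auto
    qed auto
    then have "s u = s x" if "u \<in> ball x d" for u
      using d(1) that by (metis centre_in_ball constant_on_def)
    then have "\<forall>u\<in>ball x d. euler_lagrange s a u = euler_lagrange s a x"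
      using s' s'' d(1) by (metis centre_in_ball euler_lagrange_def)
    then show "\<exists>T. open T \<and> x \<in> T \<and> (\<forall>y\<in>T \<inter> I. euler_lagrange s a y = euler_lagrange s a t)"
      using d(1) x by (intro exI[of _ "ball x d"]) auto
  qed (use I assms(2) that in \<open>auto simp: is_interval_connected_1 continuous_on_euler_lagrange\<close>)
  \<comment> \<open>The expression is now a nonzero constant on all of \<open>I\<close>, so
    \<open>*\<close> forces s' = 0 everywhere.\<close>
  have "s constant_on I"
  proof (rule has_field_derivative_0_imp_constant_on)
    show "(s has_real_derivative 0) (at u)" if "u \<in> I" for u
      using scale_has_derivs(1)[OF that] *[OF that] el[OF that] nz by auto
  qed (use I in \<open>auto simp: is_interval_connected_1\<close>)
  then show False using nonconst by simp
qed

section \<open>Criticality and the Euler-Lagrange equation\<close>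

lemma internal_parameters_imp_m_critical:
  assumes "internal_parameters I s a H"
  shows "m_critical \<Lambda> I s"
  unfolding m_critical_def
proof (intro allI impI, elim conjE)
  fix t0 t1 \<delta> F
  assume t: "t0 < t1" "{t0..t1} \<subseteq> I" and F: "admissible_variation s t0 t1 \<delta> F"
  define v where "v = (\<lambda>t. frechet_derivative F (at (0, t)) (1, 0))"
  have v: "frechet_derivative F (at (0, t)) (1, 0) = v t" for t by (simp add: v_def)
  note var = first_variation[OF I(1) smooth t F, unfolded v]
  \<comment> \<open>The Euler-Lagrange equation turns the energy gradient into a - \<Lambda>, the
    Lagrange multiplier, times the volume gradient s^2; the volume constraint then kills the
    integral.\<close>
  have "integral {t0..t1} (\<lambda>t. (1 - \<Lambda> * (s t)\<^sup>2 - (deriv s t)\<^sup>2 - 2 * s t * deriv (deriv s) t) * v t)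
     = integral {t0..t1} (\<lambda>t. (a - \<Lambda>) * ((s t)\<^sup>2 * v t))"
  proof (rule Henstock_Kurzweil_Integration.integral_cong)
    fix t assume "t \<in> {t0..t1}"
    then have "euler_lagrange s a t = 0" using internal_parameters_imp_euler_lagrange_eq_0[OF assms] t by auto
    then have "1 - \<Lambda> * (s t)\<^sup>2 - (deriv s t)\<^sup>2 - 2 * s t * deriv (deriv s) t = (a - \<Lambda>) * (s t)\<^sup>2"
      by (simp add: euler_lagrange_def algebra_simps)
    then show "(1 - \<Lambda> * (s t)\<^sup>2 - (deriv s t)\<^sup>2 - 2 * s t * deriv (deriv s) t) * v t = (a - \<Lambda>) * ((s t)\<^sup>2 * v t)"
      by simp
  qed
  then show "((\<lambda>\<epsilon>. total_energy \<Lambda> (\<lambda>t. F (\<epsilon>, t)) t0 t1) has_real_derivative 0) (at 0)"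
    using var(1)[of \<Lambda>] var(2) by simp
qed

text \<open>
  With the factor \<open>(1 + \<epsilon> u)\<^sup>1\<^sup>/\<^sup>3\<close> the volume is affine in \<open>\<epsilon>\<close>, so it is preserved exactly as soon
  as \<open>\<integral> s\<^sup>3 u = 0\<close>, and nonnegativity is automatic even at zeros of \<open>s\<close>.
\<close>

lemma admissible_variation_cube_root:
  assumes t: "t0 < t1" "{t0..t1} \<subseteq> I" and u: "smooth_on I u" "u t0 = 0" "u t1 = 0"
    and int: "integral {t0..t1} (\<lambda>t. s t ^ 3 * u t) = 0"
  shows "\<exists>\<delta>. admissible_variation s t0 t1 \<delta> (\<lambda>x. s (snd x) * (1 + fst x * u (snd x)) powr (1 / 3))"
proof -
  have "t0 \<in> I" "t1 \<in> I" using t by auto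
  then obtain d0 d1 where d: "d0 > 0" "cball t0 d0 \<subseteq> I" "d1 > 0" "cball t1 d1 \<subseteq> I"
    using I(1) by (meson open_contains_cball)
  \<comment> \<open>A margin on both sides of the interval, on which the variation must still be
    smooth.\<close>
  define \<eta> where "\<eta> = min d0 d1"
  have sub: "{t0-\<eta>..t1+\<eta>} \<subseteq> I"
  proof
    fix x assume x: "x \<in> {t0-\<eta>..t1+\<eta>}"
    consider "x \<in> cball t0 d0" | "x \<in> cball t1 d1" | "x \<in> {t0..t1}"
      using x by (force simp: dist_real_def \<eta>_def)
    then show "x \<in> I" using d t by cases auto
  qed
  have "compact (u ` {t0-\<eta>..t1+\<eta>})"
    by (intro compact_continuous_image continuous_on_subset[OF smooth_on_imp_continuous_on[OF u(1)] sub]) simp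
  then have "bounded (u ` {t0-\<eta>..t1+\<eta>})" by (rule compact_imp_bounded)
  then obtain B where B: "B > 0" "\<And>x. x \<in> {t0-\<eta>..t1+\<eta>} \<Longrightarrow> \<bar>u x\<bar> \<le> B"
    unfolding bounded_pos by auto
  \<comment> \<open>This keeps |\<epsilon> u| below 1, so the base of the power stays
    positive.\<close>
  define \<delta> where "\<delta> = 1 / B"
  have \<eta>: "\<eta> > 0" and \<delta>: "\<delta> > 0" using d B by (auto simp: \<eta>_def \<delta>_def)
  have pos: "1 + \<epsilon> * u x > 0" if "\<epsilon> \<in> {-\<delta><..<\<delta>}" "x \<in> {t0-\<eta>..t1+\<eta>}" for \<epsilon> x
  proof -
    have "\<bar>\<epsilon> * u x\<bar> \<le> \<bar>\<epsilon>\<bar> * B" unfolding abs_mult by (intro mult_left_mono B that) simp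
    also have "\<dots> < \<delta> * B" using that B by (intro mult_strict_right_mono) auto
    finally show ?thesis using B by (simp add: \<delta>_def)
  qed
  let ?S = "{-\<delta><..<\<delta>} \<times> {t0-\<eta><..<t1+\<eta>}"
  have S: "open ?S" "?S \<subseteq> UNIV \<times> I" using sub by (auto intro: open_Times)
  have "smooth_on ?S (\<lambda>x. s (snd x) * (1 + fst x * u (snd x)) powr (1 / 3))"
    by (intro smooth_on_mult smooth_on_powr smooth_on_add smooth_on_const S(1)
        smooth_on_subset[OF smooth_on_compose_snd[OF I(1)] S(2)] smooth u(1)
        smooth_on_bounded_linear bounded_linear_fst)
      (auto intro!: pos)
  moreover have "(s x * (1 + \<epsilon> * u x) powr (1 / 3)) ^ 3 = s x ^ 3 + \<epsilon> * (s x ^ 3 * u x)"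
    if "\<epsilon> \<in> {-\<delta><..<\<delta>}" "x \<in> {t0..t1}" for \<epsilon> x
  proof -
    have "1 + \<epsilon> * u x > 0" using that \<eta> by (intro pos) auto
    then have "((1 + \<epsilon> * u x) powr (1 / 3)) ^ 3 = 1 + \<epsilon> * u x"
      by (simp add: powr_power)
    then show ?thesis by (simp add: power_mult_distrib algebra_simps)
  qed
  then have "integral {t0..t1} (\<lambda>x. (s x * (1 + \<epsilon> * u x) powr (1 / 3)) ^ 3)
      = integral {t0..t1} (\<lambda>x. s x ^ 3 + \<epsilon> * (s x ^ 3 * u x))" if "\<epsilon> \<in> {-\<delta><..<\<delta>}" for \<epsilon>
    using that by (intro Henstock_Kurzweil_Integration.integral_cong) auto
  moreover have "integral {t0..t1} (\<lambda>x. s x ^ 3 + \<epsilon> * (s x ^ 3 * u x))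
      = integral {t0..t1} (\<lambda>x. s x ^ 3) + integral {t0..t1} (\<lambda>x. \<epsilon> * (s x ^ 3 * u x))" for \<epsilon>
    using t(2) by (intro integral_add integrable_continuous_real continuous_intros
        continuous_on_subset[OF continuous_on_scale_derivs(1)]
        continuous_on_subset[OF smooth_on_imp_continuous_on[OF u(1)]]) auto
  ultimately show ?thesis
    unfolding admissible_variation_def
    using \<eta> \<delta> nonneg t u int by (intro exI[of _ \<delta>] conjI exI[of _ \<eta>]) (auto simp: subset_iff)
qed

text \<open>A fundamental lemma of the calculus of variations with a constraint: s E is split, in
  the inner product with weight \<open>r\<close>, into a multiple of s^3 and an orthogonal part
  \<open>h\<close>, and testing with \<open>r h\<close> gives \<open>h = 0\<close>. The factor
  \<open>s\<close> in the conclusion comes from the variation field s u / 3.\<close>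

lemma m_critical_imp_euler_lagrange_interval:
  assumes crit: "m_critical \<Lambda> I s" and t: "{t0..t1} \<subseteq> I" "\<tau> \<in> {t0<..<t1}" "s \<tau> > 0"
  shows "\<exists>a. \<forall>t\<in>{t0<..<t1}. s t * euler_lagrange s a t = 0"
proof -
  have lt: "t0 < t1" using t(2) by simp
  define E where "E = (\<lambda>t. 1 - \<Lambda> * (s t)\<^sup>2 - (deriv s t)\<^sup>2 - 2 * s t * deriv (deriv s) t)"
  \<comment> \<open>Vanishing at the ends fixes the endpoints of the variation; positivity inside
    makes \<open>r\<close> a weight.\<close>
  define r where "r = (\<lambda>t. (t - t0) * (t1 - t))"
  have sms: "smooth_on I (deriv s)" "smooth_on I (deriv (deriv s))"
    by (intro smooth_on_deriv I smooth)+
  have conts: "continuous_on {t0..t1} s" "continuous_on {t0..t1} (deriv s)" "continuous_on {t0..t1} (deriv (deriv s))"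
    by (rule continuous_on_subset[OF _ t(1)], rule continuous_on_scale_derivs)+
  note [continuous_intros] = conts
  have contE [continuous_intros]: "continuous_on {t0..t1} E"
    unfolding E_def by (intro continuous_intros)
  have contr [continuous_intros]: "continuous_on A r" for A
    unfolding r_def by (intro continuous_intros)
  have rpos: "r t \<ge> 0" if "t \<in> {t0..t1}" for t using that by (simp add: r_def)
  have rpos': "r t > 0" if "t \<in> {t0<..<t1}" for t using that by (simp add: r_def)
  have vanish: "f x = 0"
    if "continuous_on {t0..t1} f" "integral {t0..t1} (\<lambda>t. r t * (f t)\<^sup>2) = 0" "x \<in> {t0<..<t1}"
    for f :: "real \<Rightarrow> real" and x
  proof -
    have cont: "continuous_on {t0..t1} (\<lambda>t. r t * (f t)\<^sup>2)"
      by (intro continuous_intros that(1))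
    then have "((\<lambda>t. r t * (f t)\<^sup>2) has_integral 0) (cbox t0 t1)"
      using integrable_integral[OF integrable_continuous_real[OF cont]] that(2) by simp
    from has_integral_0_cbox_imp_0[OF _ _ this, of x] have "r x * (f x)\<^sup>2 = 0"
      using that rpos lt cont by simp
    then show ?thesis using rpos'[OF that(3)] by simp
  qed
  define N where "N = integral {t0..t1} (\<lambda>t. r t * (s t ^ 3)\<^sup>2)"
  \<comment> \<open>If the weighted norm of s^3 were 0, then \<open>s\<close> would vanish at
    \<tau>.\<close>
  have "N \<noteq> 0" using vanish[of "\<lambda>t. s t ^ 3" \<tau>] t(2,3) by (auto simp: N_def intro!: continuous_intros)
  \<comment> \<open>The coefficient of the projection of s E onto s^3, chosen so that the integral
    of s^3 u is 0.\<close>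
  define c where "c = integral {t0..t1} (\<lambda>t. s t ^ 3 * (r t * (s t * E t))) / N"
  define h where "h = (\<lambda>t. s t * E t - c * s t ^ 3)"
  define u where "u = (\<lambda>t. r t * h t)"
  have conth [continuous_intros]: "continuous_on {t0..t1} h"
    unfolding h_def by (intro continuous_intros)
  have contu [continuous_intros]: "continuous_on {t0..t1} u"
    unfolding u_def by (intro continuous_intros)
  have smooth_diff: "smooth_on I (\<lambda>x. f x - g x)" if "smooth_on I f" "smooth_on I g" for f g :: "real \<Rightarrow> real"
    using smooth_on_add[OF I(1) that(1) smooth_on_mult[OF I(1) smooth_on_const[OF I(1)] that(2)], of "-1"] by simp
  have "smooth_on I u"
    unfolding u_def h_def r_def E_def power2_eq_square power3_eq_cube
    by (intro smooth_diff smooth_on_mult smooth_on_const smooth sms I(1)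
        smooth_on_bounded_linear bounded_linear_ident)
  have vol: "integral {t0..t1} (\<lambda>t. s t ^ 3 * u t) = 0"
  proof -
    have "integral {t0..t1} (\<lambda>t. s t ^ 3 * u t) =
      integral {t0..t1} (\<lambda>t. s t ^ 3 * (r t * (s t * E t)) - c * (r t * (s t ^ 3)\<^sup>2))"
      by (simp add: u_def h_def algebra_simps power2_eq_square)
    also have "\<dots> = integral {t0..t1} (\<lambda>t. s t ^ 3 * (r t * (s t * E t))) - integral {t0..t1} (\<lambda>t. c * (r t * (s t ^ 3)\<^sup>2))"
      by (intro integral_diff integrable_continuous_real continuous_intros)
    also have "\<dots> = 0" using \<open>N \<noteq> 0\<close> by (simp add: c_def N_def)
    finally show ?thesis .
  qed
  define F where "F = (\<lambda>x. s (snd x) * (1 + fst x * u (snd x)) powr (1 / 3))"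
  obtain \<delta> where F: "admissible_variation s t0 t1 \<delta> F"
    unfolding F_def
    using admissible_variation_cube_root[OF lt t(1) \<open>smooth_on I u\<close> _ _ vol] by (auto simp: u_def r_def)
  define v where "v = (\<lambda>t. frechet_derivative F (at (0, t)) (1, 0))"
  have v: "v t = s t * u t / 3" if "t \<in> {t0..t1}" for t
  proof -
    from F obtain \<eta> where "\<eta> > 0" "smooth_on ({-\<delta><..<\<delta>} \<times> {t0-\<eta><..<t1+\<eta>}) F" "\<delta> > 0"
      unfolding admissible_variation_def by blast
    then have "((\<lambda>\<epsilon>. F (\<epsilon>, t)) has_real_derivative v t) (at 0)"
      unfolding v_def by (intro smooth_on_has_real_derivative_fst) (use that in auto)
    moreover have "((\<lambda>\<epsilon>. F (\<epsilon>, t)) has_real_derivative s t * u t / 3) (at 0)"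
      unfolding F_def by (auto intro!: derivative_eq_intros)
    ultimately show ?thesis by (rule DERIV_unique)
  qed
  have "((\<lambda>\<epsilon>. total_energy \<Lambda> (\<lambda>t. F (\<epsilon>, t)) t0 t1) has_real_derivative 0) (at 0)"
    using crit lt t(1) F unfolding m_critical_def by blast
  from DERIV_unique[OF this first_variation(1)[OF I(1) smooth lt t(1) F, of \<Lambda>]]
  have "integral {t0..t1} (\<lambda>t. E t * v t) = 0" unfolding E_def v_def by simp
  \<comment> \<open>Here s E = h + c s^3 is inserted; the second summand drops out by
    \<open>vol\<close>.\<close>
  also have "integral {t0..t1} (\<lambda>t. E t * v t) = integral {t0..t1} (\<lambda>t. 1 / 3 * (r t * (h t)\<^sup>2 + c * (s t ^ 3 * u t)))"
    by (rule Henstock_Kurzweil_Integration.integral_cong)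
      (simp add: v u_def h_def algebra_simps power2_eq_square add_divide_distrib diff_divide_distrib)
  also have "\<dots> = 1 / 3 * (integral {t0..t1} (\<lambda>t. r t * (h t)\<^sup>2) + integral {t0..t1} (\<lambda>t. c * (s t ^ 3 * u t)))"
    by (subst integral_add[symmetric]) (auto intro!: integrable_continuous_real continuous_intros)
  finally have "integral {t0..t1} (\<lambda>t. r t * (h t)\<^sup>2) = 0" using vol by simp
  then have "h t = 0" if "t \<in> {t0<..<t1}" for t using vanish[OF conth] that by blast
  \<comment> \<open>\<open>h\<close> is -s times the Euler-Lagrange expression with a = \<Lambda> +
    c, so \<open>c\<close> is the Lagrange multiplier.\<close>
  then have "\<forall>t\<in>{t0<..<t1}. s t * euler_lagrange s (\<Lambda> + c) t = 0"
    by (simp add: h_def E_def euler_lagrange_def algebra_simps power3_eq_cube power2_eq_square)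
  then show ?thesis ..
qed

text \<open>The constant found on an interval could depend on it. All intervals used contain one
  point \<tau> with \<open>s\<close> positive, where the equation determines the constant.\<close>

lemma m_critical_imp_euler_lagrange_eq_0:
  assumes "m_critical \<Lambda> I s"
  shows "\<exists>a. \<forall>t\<in>I. euler_lagrange s a t = 0"
proof -
  obtain \<tau> where \<tau>: "\<tau> \<in> I" "s \<tau> > 0"
    using nonconst nonneg unfolding constant_on_def by (metis order_le_less)
  define a where "a = (1 - 2 * s \<tau> * deriv (deriv s) \<tau> - (deriv s \<tau>)\<^sup>2) / (s \<tau>)\<^sup>2"
  have a: "b = a" if "euler_lagrange s b \<tau> = 0" for b
    using that \<tau>(2) by (simp add: a_def euler_lagrange_def field_simps)
  have *: "s t * euler_lagrange s a t = 0" if t: "t \<in> I" for t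
  proof -
    \<comment> \<open>The interval is widened because the equation is obtained only at interior
      points, and both \<open>t\<close> and \<tau> must be among them.\<close>
    obtain d0 d1 where d: "d0 > 0" "cball (min t \<tau>) d0 \<subseteq> I" "d1 > 0" "cball (max t \<tau>) d1 \<subseteq> I"
      using I(1) \<tau>(1) t by (metis max_def min_def open_contains_cball)
    define t0 t1 where "t0 = min t \<tau> - d0" and "t1 = max t \<tau> + d1"
    have "t0 \<in> I" "t1 \<in> I" using d by (auto simp: t0_def t1_def dist_real_def subset_iff)
    then have sub: "{t0..t1} \<subseteq> I" using I(2) by (meson interval_subset_is_interval box_real(2) cbox_interval is_interval_1 subsetI atLeastAtMost_iff)
    have mem: "t \<in> {t0<..<t1}" "\<tau> \<in> {t0<..<t1}" using d by (auto simp: t0_def t1_def)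
    obtain b where b: "\<forall>t\<in>{t0<..<t1}. s t * euler_lagrange s b t = 0"
      using m_critical_imp_euler_lagrange_interval[OF assms sub mem(2) \<tau>(2)] by blast
    then have "b = a" using bspec[OF b mem(2)] \<tau>(2) by (intro a) simp
    then show ?thesis using b mem(1) by blast
  qed
  \<comment> \<open>At a zero of \<open>s\<close> the expression equals -1, so these open sets
    partition \<open>I\<close>. By connectedness one of them is empty, and \<tau> lies in
    \<open>?U\<close>.\<close>
  let ?U = "I \<inter> s -` (- {0})" and ?V = "I \<inter> euler_lagrange s a -` (- {0})"
  have "open ?U" "open ?V"
    by (intro continuous_open_preimage continuous_on_scale_derivs continuous_on_euler_lagrange I(1) open_Compl closed_singleton)+
  moreover have V: "s t = 0 \<longleftrightarrow> t \<in> ?V" if "t \<in> I" for t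
    using *[OF that] deriv_scale_eq_0[OF that] that by (auto simp: euler_lagrange_def)
  then have "?U \<inter> ?V \<inter> I = {}" "I \<subseteq> ?U \<union> ?V" by auto
  ultimately have "?U \<inter> I = {} \<or> ?V \<inter> I = {}"
    using I(2) by (intro connectedD) (auto simp: is_interval_connected_1)
  then have "?V = {}" using \<tau> by auto
  then have "\<forall>t\<in>I. euler_lagrange s a t = 0" by auto
  then show ?thesis ..
qed

end

section \<open>The characterization and the state equation\<close>

theorem proposition1:
  fixes I :: "real set" and s m p :: "real \<Rightarrow> real" and \<Lambda> :: real
  assumes "closed_RW_spacetime I s \<Lambda> m p"
    and "\<not> s constant_on I"
  shows "(m_critical \<Lambda> I s \<longleftrightarrow> (\<exists>a H. internal_parameters I s a H)) \<and>
    (\<forall>a H. m_critical \<Lambda> I s \<and> internal_parameters I s a H \<longrightarrow>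
      (\<forall>t\<in>I. s t > 0 \<longrightarrow>
        8 * pi / 3 * m t + 8 * pi * p t - 2 / 3 * (\<Lambda> + a)
          - H / (2 * sqrt 2) * (\<Lambda> + a - 8 * pi * p t) powr (3 / 2) = 0))"
proof (intro conjI allI impI ballI, goal_cases)
  have I: "open I" "is_interval I" and smooth: "smooth_on I s"
    and nonneg: "\<And>t. t \<in> I \<Longrightarrow> s t \<ge> 0" and einstein: "einstein_equation I s \<Lambda> m p"
    using assms(1) by (auto simp: closed_RW_spacetime_def)
  note scale = I smooth nonneg assms(2)
  case 1
  show ?case
    using m_critical_imp_euler_lagrange_eq_0[OF scale] euler_lagrange_eq_0_imp_internal_parameters[OF scale]
      internal_parameters_imp_m_critical[OF scale] by meson
  case (2 a H t)
  then have H: "s t * ((deriv s t)\<^sup>2 + a / 3 * (s t)\<^sup>2 - 1) = H"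
    by (simp add: internal_parameters_def)
  have el: "euler_lagrange s a t = 0"
    using internal_parameters_imp_euler_lagrange_eq_0[OF scale] 2 by blast
  have mp: "m t = energy_density \<Lambda> s t"
     "p t = - 1 / (4 * pi * s t) * (deriv (deriv s) t + 1 / (2 * s t) * ((deriv s t)\<^sup>2 + 1) - \<Lambda> / 2 * s t)"
    using einstein_equation_iff[OF I(1) scale_has_derivs[OF scale]] einstein 2 by auto
  define S where "S = s t"
  have S: "S > 0" using 2 by (simp add: S_def)
  \<comment> \<open>The Euler-Lagrange equation eliminates s'' and s' together, leaving \<Lambda> +
    a - 8 pi p = 2 / s^2; the power 3/2 then expresses 1 / s^3 through the pressure.\<close>
  have "8 * pi * p t = \<Lambda> - (2 * S * deriv (deriv s) t + (deriv s t)\<^sup>2 + 1) / S\<^sup>2"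
    unfolding mp S_def[symmetric] using S by (simp add: field_simps power2_eq_square)
  also have "2 * S * deriv (deriv s) t + (deriv s t)\<^sup>2 + 1 = 2 - a * S\<^sup>2"
    using el by (simp add: euler_lagrange_def S_def)
  finally have p: "8 * pi * p t = \<Lambda> + a - 2 / S\<^sup>2"
    using S by (simp add: field_simps)
  have "(2 / S\<^sup>2) powr (3 / 2) = (sqrt 2 / S) ^ 3"
  proof -
    have "2 / S\<^sup>2 = (sqrt 2 / S) powr 2" using S by (simp add: power_divide)
    then have "(2 / S\<^sup>2) powr (3 / 2) = (sqrt 2 / S) powr 3" by (simp add: powr_powr)
    then show ?thesis using S by simp
  qed
  then have pw: "(\<Lambda> + a - 8 * pi * p t) powr (3 / 2) = 2 * sqrt 2 / S ^ 3"
    by (simp add: p power_divide power3_eq_cube)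
  have "8 * pi / 3 * m t = ((deriv s t)\<^sup>2 + 1) / S\<^sup>2 - \<Lambda> / 3"
    unfolding mp energy_density_def S_def[symmetric] using S by (simp add: field_simps)
  \<comment> \<open>The first integral removes s' from the energy density and brings in
    \<open>H\<close>.\<close>
  also have "(deriv s t)\<^sup>2 = H / S + 1 - a / 3 * S\<^sup>2"
    using H S by (simp add: S_def field_simps power2_eq_square)
  finally have "8 * pi / 3 * m t = H / S ^ 3 + 2 / S\<^sup>2 - a / 3 - \<Lambda> / 3"
    using S by (simp add: field_simps power2_eq_square power3_eq_cube)
  then show ?case unfolding pw unfolding p by (simp add: field_simps)
qed

end
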